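(* In the setting described in the context (with $f_i,g_i,h_i,\lambda_i,\mu_i$ satisfying all standing assumptions there), suppose that $\mu_1=\mu_2=1$ and $$\int_1^\infty\left(\zeta^{\lambda_1\lambda_2}g_1(\zeta)g_2^{\lambda_1}(\zeta)\right)^{-1/(m_1+\lambda_1m_2)}\zeta^{1/(m_1+\lambda_1m_2)-1}\,d\zeta<\infty.$$ Then all solutions $(u_1,u_2)$ of the system $$\sum_{|\alpha|=m_1}\partial^\alpha a_\alpha(x,u_1)\ge f_1(|u_2|),\qquad \sum_{|\alpha|=m_2}\partial^\alpha b_\alpha(x,u_2)\ge f_2(|u_1|)\quad\text{in }\mathbb R^n$$ are trivial, i.e. $u_1=u_2=0$ almost everywhere in $\mathbb R^n$.
   Context: Setting and standing assumptions. Let $n,m_1,m_2\ge1$ be integers. For multi-indices $\alpha$ with $|\alpha|=m_1$ and $\beta$ with $|\beta|=m_2$ let $a_\alpha,b_\beta:\mathbb R^n\times\mathbb R\to\mathbb R$ be Carathéodory functions such that, with some constant $A>0$, $|a_\alpha(x,\zeta)|+|b_\beta(x,\zeta)|\le A|\zeta|$ for almost all $x\in\mathbb R^n$ and all $\zeta\in\mathbb R$. Let $f_1,f_2:[0,\infty)\to[0,\infty)$ be non-decreasing and convex. Assume there are real numbers $\lambda_i,\mu_i\in[1,\infty)$ and non-decreasing continuous functions $g_i:[1,\infty)\to(0,\infty)$ and $h_i:(0,1]\to(0,\infty)$, $i=1,2$, such that $f_i(\zeta)\ge\zeta^{\lambda_i}g_i(\zeta)$ for all $\zeta\in[1,\infty)$,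 $f_i(\zeta)\ge\zeta^{\mu_i}h_i(\zeta)$ for all $\zeta\in(0,1]$, and, for all $\varkappa\in(0,1)$, $$\liminf_{\zeta\to\infty}\frac{g_i(\zeta^\varkappa)}{g_i(\zeta)}>0,\qquad \liminf_{\zeta\to+0}\frac{h_i(\zeta)}{h_i(\zeta^\varkappa)}>0 .$$ Solutions. Functions $u_1,u_2\in L_{1,loc}(\mathbb R^n)$ are called solutions of the system if $f_1(|u_2|),f_2(|u_1|)\in L_{1,loc}(\mathbb R^n)$ and, for every non-negative $\varphi\in C_0^\infty(\mathbb R^n)$, $$(-1)^{m_1}\int_{\mathbb R^n}\sum_{|\alpha|=m_1}a_\alpha(x,u_1)\,\partial^\alpha\varphi\,dx\ge\int_{\mathbb R^n}f_1(|u_2|)\varphi\,dx,\qquad (-1)^{m_2}\int_{\mathbb R^n}\sum_{|\alpha|=m_2}b_\alpha(x,u_2)\,\partial^\alpha\varphi\,dx\ge\int_{\mathbb R^n}f_2(|u_1|)\varphi\,dx .$$ *)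

theory Defs
  imports "HOL-Analysis.Analysis"
begin

definition partial_deriv :: "'n::finite \<Rightarrow> (real^'n \<Rightarrow> real) \<Rightarrow> real^'n \<Rightarrow> real" where
  "partial_deriv i \<phi> x = deriv (\<lambda>t. \<phi> (x + t *\<^sub>R axis i 1)) 0"

primrec iter_partial :: "'n::finite list \<Rightarrow> (real^'n \<Rightarrow> real) \<Rightarrow> real^'n \<Rightarrow> real" where
  "iter_partial [] \<phi> = \<phi>"
| "iter_partial (i # is) \<phi> = partial_deriv i (iter_partial is \<phi>)"

text \<open>Partial derivatives of all orders exist and are continuous. Existence has to be required
  explicitly, since deriv is total.\<close>

definition C_infinity :: "(real^'n::finite \<Rightarrow> real) \<Rightarrow> bool" where
  "C_infinity \<phi> \<longleftrightarrow> (\<forall>is. continuous_on UNIV (iter_partial is \<phi>) \<and>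
     (\<forall>i x. (\<lambda>t. iter_partial is \<phi> (x + t *\<^sub>R axis i 1)) differentiable (at 0)))"

definition C_infinity_compact :: "(real^'n::finite \<Rightarrow> real) \<Rightarrow> bool" where
  "C_infinity_compact \<phi> \<longleftrightarrow> C_infinity \<phi> \<and> compact (closure {x. \<phi> x \<noteq> 0})"

definition multi_indices :: "nat \<Rightarrow> ('n::finite \<Rightarrow> nat) set" where
  "multi_indices m = {\<alpha>. (\<Sum>i\<in>UNIV. \<alpha> i) = m}"

text \<open>The coordinates carry no canonical order, so the order of differentiation is chosen
  arbitrarily. For smooth functions, the only ones this is applied to, mixed partial derivatives
  commute and the choice is immaterial.\<close>

definition multi_deriv :: "('n::finite \<Rightarrow> nat) \<Rightarrow> (real^'n \<Rightarrow> real) \<Rightarrow> real^'n \<Rightarrow> real" where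
  "multi_deriv \<alpha> \<phi> = iter_partial (SOME is. \<forall>i. count_list is i = \<alpha> i) \<phi>"

lemma ex_list_of_multi_index:
  fixes \<alpha> :: "'n::finite \<Rightarrow> nat"
  shows "\<exists>is. \<forall>i. count_list is i = \<alpha> i"
proof -
  have "\<exists>is. \<forall>i. count_list is i = (if i \<in> S then \<alpha> i else 0)" if "finite S" for S :: "'n set"
    using that
  proof (induction S rule: finite_induct)
    case empty
    show ?case by (rule exI[of _ "[]"]) simp
  next
    case (insert j S)
    then obtain "is" where "is": "\<forall>i. count_list is i = (if i \<in> S then \<alpha> i else 0)" by blast
    have rep: "count_list (replicate k j) i = (if i = j then k else 0)" for k i
      by (induction k) auto
    show ?case
      using "is" insert.hyps by (intro exI[of _ "replicate (\<alpha> j) j @ is"]) (auto simp: rep)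
  qed
  from this[of UNIV] show ?thesis by simp
qed

lemma finite_multi_indices: "finite (multi_indices m :: ('n::finite \<Rightarrow> nat) set)"
proof (rule finite_subset)
  show "(multi_indices m :: ('n \<Rightarrow> nat) set) \<subseteq> PiE UNIV (\<lambda>_. {..m})"
  proof
    fix \<alpha> :: "'n \<Rightarrow> nat"
    assume "\<alpha> \<in> multi_indices m"
    then have "\<alpha> i \<le> m" for i
      using member_le_sum[of i UNIV \<alpha>] by (simp add: multi_indices_def)
    then show "\<alpha> \<in> PiE UNIV (\<lambda>_. {..m})" by auto
  qed
  show "finite (PiE (UNIV :: 'n set) (\<lambda>_. {..m}))"
    by (intro finite_PiE) auto
qed

definition L1_loc :: "('a::euclidean_space \<Rightarrow> real) \<Rightarrow> bool" where
  "L1_loc u \<longleftrightarrow> (\<forall>K. compact K \<longrightarrow> u absolutely_integrable_on K)"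

definition caratheodory :: "('a::euclidean_space \<Rightarrow> real \<Rightarrow> real) \<Rightarrow> bool" where
  "caratheodory a \<longleftrightarrow>
     (\<forall>\<zeta>. (\<lambda>x. a x \<zeta>) \<in> borel_measurable lebesgue) \<and>
     (AE x in lebesgue. continuous_on UNIV (a x))"

text \<open>The functions \<open>f\<close>, \<open>g\<close>, \<open>h\<close> live on \<open>[0,\<infinity>)\<close>, \<open>[1,\<infinity>)\<close>, \<open>(0,1]\<close>; their values elsewhere
  are irrelevant.\<close>

definition nonlinearity ::
    "(real \<Rightarrow> real) \<Rightarrow> real \<Rightarrow> real \<Rightarrow> (real \<Rightarrow> real) \<Rightarrow> (real \<Rightarrow> real) \<Rightarrow> bool" where
  "nonlinearity f lam \<mu> g h \<longleftrightarrow>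
     (\<forall>\<zeta>\<ge>0. f \<zeta> \<ge> 0) \<and> mono_on {0..} f \<and> convex_on {0..} f \<and>
     lam \<ge> 1 \<and> \<mu> \<ge> 1 \<and>
     (\<forall>\<zeta>\<ge>1. g \<zeta> > 0) \<and> mono_on {1..} g \<and> continuous_on {1..} g \<and>
     (\<forall>\<zeta>\<in>{0<..1}. h \<zeta> > 0) \<and> mono_on {0<..1} h \<and> continuous_on {0<..1} h \<and>
     (\<forall>\<zeta>\<ge>1. f \<zeta> \<ge> \<zeta> powr lam * g \<zeta>) \<and>
     (\<forall>\<zeta>\<in>{0<..1}. f \<zeta> \<ge> \<zeta> powr \<mu> * h \<zeta>) \<and>
     (\<forall>\<kappa>\<in>{0<..<1}. Liminf at_top (\<lambda>\<zeta>. ereal (g (\<zeta> powr \<kappa>) / g \<zeta>)) > 0) \<and>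
     (\<forall>\<kappa>\<in>{0<..<1}. Liminf (at_right 0) (\<lambda>\<zeta>. ereal (h \<zeta> / h (\<zeta> powr \<kappa>))) > 0)"

definition weak_ineq ::
    "nat \<Rightarrow> (('n::finite \<Rightarrow> nat) \<Rightarrow> real^'n \<Rightarrow> real \<Rightarrow> real) \<Rightarrow> (real^'n \<Rightarrow> real) \<Rightarrow> (real^'n \<Rightarrow> real) \<Rightarrow> bool"
    where
  "weak_ineq m a u F \<longleftrightarrow>
     (\<forall>\<phi>. C_infinity_compact \<phi> \<and> (\<forall>x. \<phi> x \<ge> 0) \<longrightarrow>
        (-1) ^ m * (LINT x|lebesgue. (\<Sum>\<alpha>\<in>multi_indices m. a \<alpha> x (u x) * multi_deriv \<alpha> \<phi> x))
          \<ge> (LINT x|lebesgue. F x * \<phi> x))"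

definition solution ::
    "nat \<Rightarrow> nat \<Rightarrow> (('n::finite \<Rightarrow> nat) \<Rightarrow> real^'n \<Rightarrow> real \<Rightarrow> real) \<Rightarrow>
     (('n \<Rightarrow> nat) \<Rightarrow> real^'n \<Rightarrow> real \<Rightarrow> real) \<Rightarrow> (real \<Rightarrow> real) \<Rightarrow> (real \<Rightarrow> real) \<Rightarrow>
     (real^'n \<Rightarrow> real) \<Rightarrow> (real^'n \<Rightarrow> real) \<Rightarrow> bool" where
  "solution m\<^sub>1 m\<^sub>2 a b f\<^sub>1 f\<^sub>2 u\<^sub>1 u\<^sub>2 \<longleftrightarrow>
     L1_loc u\<^sub>1 \<and> L1_loc u\<^sub>2 \<and>
     L1_loc (\<lambda>x. f\<^sub>1 \<bar>u\<^sub>2 x\<bar>) \<and> L1_loc (\<lambda>x. f\<^sub>2 \<bar>u\<^sub>1 x\<bar>) \<and>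
     weak_ineq m\<^sub>1 a u\<^sub>1 (\<lambda>x. f\<^sub>1 \<bar>u\<^sub>2 x\<bar>) \<and>
     weak_ineq m\<^sub>2 b u\<^sub>2 (\<lambda>x. f\<^sub>2 \<bar>u\<^sub>1 x\<bar>)"

end

theory Submission
  imports Defs
begin

text \<open>
  Write $Q_r$ for the cube of half side $r$, $j_1(r)$ and $j_2(r)$ for the averages over $Q_r$ of
  $f_1(|u_2|)$ and $f_2(|u_1|)$. Testing the first inequality with a smooth cutoff that is $1$ on
  $Q_r$ and vanishes outside $Q_{r+\sigma}$ bounds $j_1(r)$ by a multiple of $\sigma^{-m_1}$ times
  the average of $|u_1|$ over $Q_{r+\sigma}$ if $\sigma \le r$, and Jensen's inequality for $f_2$
  turns this into
  \[ j_2(r+\sigma) \ge f_2(c\,\sigma^{m_1} j_1(r)), \qquad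
     j_1(r+\sigma) \ge f_1(c\,\sigma^{m_2} j_2(r)) \qquad (0 < \sigma \le r), \]
  the second inequality being the symmetric one (lemma \<open>cube_average_step\<close>). The rest of the
  argument concerns only these two functions of one variable (lemma \<open>coupled_growth_blow_up\<close>).

  If $j_1$ is not identically zero, then $j_1(R) \ge a R^{-n}$ for large $R$. Starting from this
  value, $j_1$ is doubled again and again, each doubling costing two steps of some length $\sigma$.
  As $\mu_i = 1$, near zero $f_i(\zeta)$ is at least $\zeta$ divided by a power of
  $\ln(1/\zeta)$: the regularity condition on $h_i$ says that $s \mapsto 1/h_i(e^{-s})$ grows by at
  most a constant factor when $s$ is doubled, so it is bounded by a polynomial. Hence
  $O(\ln R)$ doublings with steps of length a power of $\ln R$ raise $j_1$ to any given constant.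
  Above that constant, put $w(\zeta) = (G_1(\zeta) G_2(\zeta))^{-1/(m_1+m_2)}$, where
  $f_i(\zeta) \ge \zeta G_i(\zeta)$ and $G_i$ grows at most like a power of the logarithm; a
  multiple of $w(\zeta)$ is then a sufficient step length at level $\zeta$, and the integral condition makes
  $\sum_k w(2^k)$ finite. All steps together have length at most $R$ when $R$ is large, so $j_1$
  would be unbounded on $[R, 2R]$, which contradicts local integrability. Hence $j_1 = 0$, the
  second inequality gives $j_2 = 0$, and $f_1, f_2$ are positive on $(0,\infty)$.

  The functions $G_i$ are $g_i$ if $\lambda_1 = \lambda_2 = 1$. If some $\lambda_i > 1$, the
  integral condition is automatic and plays no role: the factor $\zeta^{\lambda_i - 1}$ dominates any power of
  the logarithm, so one $G_i$ may be taken to be a high power of $1 + \ln\zeta$ and the other a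
  constant (lemma \<open>ex_summable_lower_bounds\<close>).
\<close>

section \<open>Smooth cutoff functions on cubes\<close>

text \<open>The $k$-th derivative of $\exp(-1/q)$ with $q = t(1-t)$ is $P_k\, q^{-2k} \exp(-1/q)$ on
  $(0,1)$; these are the polynomials $P_k$.\<close>

primrec bump_poly :: "nat \<Rightarrow> real poly" where
  "bump_poly 0 = 1"
| "bump_poly (Suc k) = pderiv (bump_poly k) * [:0, 1, -1:]\<^sup>2
     - smult (2 * real k) (bump_poly k * [:1, -2:] * [:0, 1, -1:]) + bump_poly k * [:1, -2:]"

text \<open>The $k$-th derivative of the standard bump function supported on $[0,1]$.\<close>

definition bump_deriv :: "nat \<Rightarrow> real \<Rightarrow> real" where
  "bump_deriv k t = (if 0 < t \<and> t < 1
     then poly (bump_poly k) t * inverse (t * (1 - t)) ^ (2 * k) * exp (- inverse (t * (1 - t))) else 0)"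

lemma power_mult_exp_minus_le:
  fixes v :: real
  assumes "v > 0"
  shows "v ^ k * exp (- v) \<le> fact (k + 2) * (inverse v)\<^sup>2"
proof -
  have "(\<lambda>n. v ^ n /\<^sub>R fact n) sums exp v" by (rule exp_converges)
  moreover from this have "(\<Sum>n\<in>{k + 2}. v ^ n /\<^sub>R fact n) \<le> (\<Sum>n. v ^ n /\<^sub>R fact n)"
    using assms by (intro sum_le_suminf) (auto simp: sums_iff)
  ultimately have "v ^ (k + 2) / fact (k + 2) \<le> exp v"
    by (simp add: sums_iff divide_inverse_commute)
  hence "v ^ k * v\<^sup>2 \<le> fact (k + 2) * exp v"
    by (simp only: power_add pos_divide_le_eq fact_gt_zero mult.commute)
  hence "v ^ k * v\<^sup>2 * exp (- v) * (inverse v)\<^sup>2 \<le> fact (k + 2) * exp v * exp (- v) * (inverse v)\<^sup>2"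
    by (intro mult_right_mono) auto
  moreover have "v ^ k * v\<^sup>2 * exp (- v) * (inverse v)\<^sup>2 = v ^ k * exp (- v)"
    using assms by (simp add: field_simps)
  moreover have "fact (k + 2) * exp v * exp (- v) * (inverse v)\<^sup>2 = fact (k + 2) * (inverse v)\<^sup>2"
    by (simp only: mult.assoc[of "fact (k + 2)"] exp_minus_inverse mult_1_right)
  ultimately show ?thesis by (simp only:)
qed

text \<open>Quadratic decay towards every point outside $(0,1)$ makes the derivative vanish there, so the
  end points need no separate treatment.\<close>

lemma bump_deriv_quadratic_bound:
  obtains C where "\<And>s t. s \<le> 0 \<or> 1 \<le> s \<Longrightarrow> \<bar>bump_deriv k t\<bar> \<le> C * (t - s)\<^sup>2"
proof -
  have "compact (poly (bump_poly k) ` {0..1})"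
    by (intro compact_continuous_image continuous_intros) auto
  then obtain M where M: "\<And>t. t \<in> {0..1} \<Longrightarrow> \<bar>poly (bump_poly k) t\<bar> \<le> M"
    by (metis bounded_iff compact_imp_bounded image_eqI real_norm_def)
  have M0: "M \<ge> 0" using M[of 0] by auto
  show ?thesis
  proof (rule that[of "M * fact (2 * k + 2)"])
    fix s t :: real
    assume s: "s \<le> 0 \<or> 1 \<le> s"
    show "\<bar>bump_deriv k t\<bar> \<le> M * fact (2 * k + 2) * (t - s)\<^sup>2"
    proof (cases "0 < t \<and> t < 1")
      case True
      define q where "q = t * (1 - t)"
      have q: "q > 0" using True by (simp add: q_def)
      have "q \<le> t" "q \<le> 1 - t"
        using True by (auto simp: q_def mult_left_le mult_right_le_one_le mult_left_le_one_le)
      hence "q \<le> \<bar>t - s\<bar>" using s True by auto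
      hence qs: "q\<^sup>2 \<le> (t - s)\<^sup>2" using q by (metis abs_of_pos abs_le_square_iff)
      have "\<bar>bump_deriv k t\<bar> = \<bar>poly (bump_poly k) t\<bar> * (inverse q ^ (2 * k) * exp (- inverse q))"
        using True q by (simp add: bump_deriv_def q_def abs_mult)
      also have "\<dots> \<le> M * (fact (2 * k + 2) * q\<^sup>2)"
      proof (rule mult_mono)
        show "inverse q ^ (2 * k) * exp (- inverse q) \<le> fact (2 * k + 2) * q\<^sup>2"
          using power_mult_exp_minus_le[of "inverse q" "2 * k"] q by (simp only: inverse_inverse_eq positive_imp_inverse_positive)
      qed (use M[of t] True q M0 in auto)
      also have "\<dots> \<le> M * (fact (2 * k + 2) * (t - s)\<^sup>2)"
        using qs M0 by (intro mult_left_mono) auto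
      finally show ?thesis by (simp add: mult.assoc)
    next
      case False
      thus ?thesis using M0 by (auto simp: bump_deriv_def)
    qed
  qed
qed

lemma bump_deriv_has_derivative: "(bump_deriv k has_real_derivative bump_deriv (Suc k) t) (at t)"
proof (cases "0 < t \<and> t < 1")
  case True
  define v where "v = inverse (t * (1 - t))"
  have v: "v \<noteq> 0" using True by (simp add: v_def)
  have q: "t * (1 - t) = inverse v" by (simp add: v_def)
  have dv: "((\<lambda>t::real. inverse (t * (1 - t))) has_real_derivative - (1 - 2 * t) * v\<^sup>2) (at t)"
    using True by (auto intro!: derivative_eq_intros simp: v_def power2_eq_square algebra_simps)
  have "((\<lambda>t. poly (bump_poly k) t * inverse (t * (1 - t)) ^ (2 * k) * exp (- inverse (t * (1 - t))))
     has_real_derivative bump_deriv (Suc k) t) (at t)"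
  proof (rule DERIV_cong)
    show "((\<lambda>t. poly (bump_poly k) t * inverse (t * (1 - t)) ^ (2 * k) * exp (- inverse (t * (1 - t))))
     has_real_derivative
       (poly (pderiv (bump_poly k)) t * v ^ (2 * k) + (real (2 * k) * (- (1 - 2 * t) * v\<^sup>2 * v ^ (2 * k - Suc 0))) * poly (bump_poly k) t) * exp (- v)
        + (exp (- v) * - (- (1 - 2 * t) * v\<^sup>2)) * (poly (bump_poly k) t * v ^ (2 * k))) (at t)"
      unfolding v_def
      by (intro DERIV_mult poly_DERIV DERIV_fun_exp DERIV_minus DERIV_power dv[unfolded v_def])
    define u where "u = inverse v"
    have uv: "u * v = 1" using v by (simp add: u_def)
    have k1: "real (2 * k) * (- (1 - 2 * t) * v\<^sup>2 * v ^ (2 * k - Suc 0)) = - 2 * real k * (1 - 2 * t) * (v ^ (2 * k) * v)"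
      by (cases k) (auto simp: power2_eq_square algebra_simps)
    have q': "poly [:0, 1, -1:] t = u" "poly [:1, -2:] t = 1 - 2 * t" by (auto simp: q[symmetric] u_def)
    have "bump_deriv (Suc k) t = (poly (pderiv (bump_poly k)) t * u\<^sup>2
       - 2 * real k * (poly (bump_poly k) t * (1 - 2 * t) * u)
       + poly (bump_poly k) t * (1 - 2 * t)) * (v ^ (2 * k) * v\<^sup>2) * exp (- v)"
      unfolding bump_deriv_def v_def[symmetric] bump_poly.simps poly_add poly_diff poly_mult poly_smult
        poly_power q' using True by (simp add: power2_eq_square)
    also have "\<dots> = (poly (pderiv (bump_poly k)) t * v ^ (2 * k) * (u * v)\<^sup>2
       - 2 * real k * (1 - 2 * t) * (v ^ (2 * k) * v) * (u * v) * poly (bump_poly k) t) * exp (- v)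
       + (exp (- v) * - (- (1 - 2 * t) * v\<^sup>2)) * (poly (bump_poly k) t * v ^ (2 * k))"
      by (simp add: algebra_simps power2_eq_square)
    finally show "(poly (pderiv (bump_poly k)) t * v ^ (2 * k) + (real (2 * k) * (- (1 - 2 * t) * v\<^sup>2 * v ^ (2 * k - Suc 0))) * poly (bump_poly k) t) * exp (- v)
        + (exp (- v) * - (- (1 - 2 * t) * v\<^sup>2)) * (poly (bump_poly k) t * v ^ (2 * k)) = bump_deriv (Suc k) t"
      unfolding k1 uv by simp
  qed
  thus ?thesis
    by (rule has_field_derivative_transform_within_open[of _ _ _ "{0<..<1}"])
       (use True in \<open>auto simp: bump_deriv_def\<close>)
next
  case False
  obtain C where C: "\<And>s t. s \<le> 0 \<or> 1 \<le> s \<Longrightarrow> \<bar>bump_deriv k t\<bar> \<le> C * (t - s)\<^sup>2"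
    using bump_deriv_quadratic_bound[of k] by blast
  have z: "bump_deriv k t = 0" "bump_deriv (Suc k) t = 0" using False by (auto simp: bump_deriv_def)
  have "((\<lambda>h. bump_deriv k (t + h) / h) \<longlongrightarrow> 0) (at 0)"
  proof (rule Lim_null_comparison)
    show "\<forall>\<^sub>F h in at 0. norm (bump_deriv k (t + h) / h) \<le> C * \<bar>h\<bar>"
    proof (intro eventuallyI)
      fix h show "norm (bump_deriv k (t + h) / h) \<le> C * \<bar>h\<bar>"
        using C[of t "t + h"] False by (cases "h = 0") (auto simp: field_simps power2_eq_square)
    qed
    have "((\<lambda>h::real. C * \<bar>h\<bar>) \<longlongrightarrow> C * \<bar>0\<bar>) (at 0)" by (intro tendsto_intros)
    thus "((\<lambda>h::real. C * \<bar>h\<bar>) \<longlongrightarrow> 0) (at 0)" by simp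
  qed
  thus ?thesis by (simp add: DERIV_def z)
qed

text \<open>A smooth transition from $0$ on $(-\infty,0]$ to $1$ on $[1,\infty)$, given together with all
  its derivatives: \<open>T k\<close> is the $k$-th one.\<close>

definition smooth_step :: "(nat \<Rightarrow> real \<Rightarrow> real) \<Rightarrow> bool" where
  "smooth_step T \<longleftrightarrow> (\<forall>k t. (T k has_real_derivative T (Suc k) t) (at t)) \<and>
     (\<forall>t\<le>0. T 0 t = 0) \<and> (\<forall>t\<ge>1. T 0 t = 1) \<and> (\<forall>t. 0 \<le> T 0 t \<and> T 0 t \<le> 1) \<and>
     (\<forall>k t. t \<le> 0 \<or> 1 \<le> t \<longrightarrow> T (Suc k) t = 0) \<and> (\<forall>k. \<exists>C. \<forall>t. \<bar>T k t\<bar> \<le> C)"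

lemma ex_smooth_step: "\<exists>T. smooth_step T"
proof -
  have cont: "continuous_on S (bump_deriv k)" for S k
    by (meson DERIV_continuous_on bump_deriv_has_derivative has_field_derivative_at_within)
  have "\<exists>F. \<forall>x::real. -\<infinity> < ereal x \<longrightarrow> ereal x < \<infinity> \<longrightarrow> (F has_vector_derivative bump_deriv 0 x) (at x)"
    by (rule einterval_antiderivative) (use cont[of UNIV 0] in \<open>auto simp: continuous_on_eq_continuous_at\<close>)
  then obtain F where F: "\<And>x::real. (F has_real_derivative bump_deriv 0 x) (at x)"
    by (auto simp: has_real_derivative_iff_has_vector_derivative)
  have nonneg: "bump_deriv 0 x \<ge> 0" for x by (simp add: bump_deriv_def)
  have mono: "F x \<le> F y" if "x \<le> y" for x y
    by (rule DERIV_nonneg_imp_nondecreasing[OF that]) (use F nonneg in blast)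
  have flat: "(F has_real_derivative 0) (at x)" if "x \<le> 0 \<or> 1 \<le> x" for x
    using F[of x] that by (simp add: bump_deriv_def split: if_splits)
  have left: "F x = F 0" if "x \<le> 0" for x
  proof (cases "x = 0")
    case False
    have "F 0 = F x"
      by (rule DERIV_isconst_end)
        (use that False flat in \<open>auto intro!: continuous_at_imp_continuous_on F[THEN DERIV_isCont]\<close>)
    thus ?thesis by simp
  qed simp
  have right: "F x = F 1" if "x \<ge> 1" for x
  proof (cases "x = 1")
    case False
    show ?thesis
      by (rule DERIV_isconst_end)
        (use that False flat in \<open>auto intro!: continuous_at_imp_continuous_on F[THEN DERIV_isCont]\<close>)
  qed simp
  have "\<exists>z. z > 0 \<and> z < 1 \<and> F 1 - F 0 = (1 - 0) * bump_deriv 0 z"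
    by (rule MVT2) (use F in auto)
  hence pos: "F 1 - F 0 > 0" unfolding bump_deriv_def by force
  define T where "T k t = (case k of 0 \<Rightarrow> (F t - F 0) / (F 1 - F 0) | Suc l \<Rightarrow> bump_deriv l t / (F 1 - F 0))" for k t
  have "smooth_step T"
    unfolding smooth_step_def
  proof (intro conjI allI impI)
    fix k t show "(T k has_real_derivative T (Suc k) t) (at t)"
      using pos by (cases k) (auto simp: T_def[abs_def] intro!: derivative_eq_intros F bump_deriv_has_derivative)
  next
    fix t :: real assume "t \<le> 0" thus "T 0 t = 0" using left[of t] by (simp add: T_def)
  next
    fix t :: real assume "t \<ge> 1" thus "T 0 t = 1" using right[of t] pos by (simp add: T_def)
  next
    fix t show "0 \<le> T 0 t"
      using mono[of 0 t] left[of t] pos by (cases "t \<le> 0") (auto simp: T_def)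
  next
    fix t show "T 0 t \<le> 1"
      using mono[of t 1] right[of t] pos by (cases "t \<le> 1") (auto simp: T_def)
  next
    fix k and t :: real assume "t \<le> 0 \<or> 1 \<le> t" thus "T (Suc k) t = 0" by (auto simp: T_def bump_deriv_def)
  next
    fix k
    show "\<exists>C. \<forall>t. \<bar>T k t\<bar> \<le> C"
    proof (cases k)
      case 0
      have "\<bar>T 0 t\<bar> \<le> 1" for t
        using mono[of 0 t] left[of t] mono[of t 1] right[of t] pos by (cases "t \<le> 0"; cases "t \<le> 1") (auto simp: T_def)
      thus ?thesis using 0 by blast
    next
      case (Suc l)
      obtain C where C: "\<And>s t. s \<le> 0 \<or> 1 \<le> s \<Longrightarrow> \<bar>bump_deriv l t\<bar> \<le> C * (t - s)\<^sup>2"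
        using bump_deriv_quadratic_bound[of l] by blast
      have C0: "C \<ge> 0" using C[of 0 1] by auto
      have "\<bar>bump_deriv l t\<bar> \<le> C" for t
      proof (cases "0 < t \<and> t < 1")
        case True
        have "t\<^sup>2 \<le> 1" using True by (simp add: power_le_one)
        thus ?thesis using C[of 0 t] mult_left_mono[of "t\<^sup>2" 1 C] C0 by simp
      next
        case False
        thus ?thesis using C0 by (auto simp: bump_deriv_def)
      qed
      hence "\<bar>T k t\<bar> \<le> C / (F 1 - F 0)" for t
        using pos by (simp add: Suc T_def divide_right_mono)
      thus ?thesis by blast
    qed
  qed
  thus ?thesis by blast
qed

text \<open>The $k$-th derivative of the function that is $1$ on $[-r,r]$, vanishes outside
  $[-r-\sigma,r+\sigma]$ and has transitions of width $\sigma$. It is a difference, not a product, of two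
  transitions, so that its derivatives are bounded without the Leibniz rule.\<close>

definition plateau :: "(nat \<Rightarrow> real \<Rightarrow> real) \<Rightarrow> real \<Rightarrow> real \<Rightarrow> nat \<Rightarrow> real \<Rightarrow> real" where
  "plateau T r \<sigma> k t = (T k ((t + r + \<sigma>) / \<sigma>) - T k ((t - r) / \<sigma>)) / \<sigma> ^ k"

context
  fixes T :: "nat \<Rightarrow> real \<Rightarrow> real" and r \<sigma> :: real
  assumes T: "smooth_step T" and r: "r \<ge> 0" and \<sigma>: "\<sigma> > 0"
begin

lemma plateau_has_derivative:
  "(plateau T r \<sigma> k has_real_derivative plateau T r \<sigma> (Suc k) t) (at t)"
proof -
  have T': "(T k has_real_derivative T (Suc k) s) (at s)" for s using T by (auto simp: smooth_step_def)
  have 1: "((\<lambda>t. T k ((t + r + \<sigma>) / \<sigma>)) has_real_derivative T (Suc k) ((t + r + \<sigma>) / \<sigma>) * (1 / \<sigma>)) (at t)"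
    by (rule DERIV_chain'[OF _ T']) (use \<sigma> in \<open>auto intro!: derivative_eq_intros\<close>)
  have 2: "((\<lambda>t. T k ((t - r) / \<sigma>)) has_real_derivative T (Suc k) ((t - r) / \<sigma>) * (1 / \<sigma>)) (at t)"
    by (rule DERIV_chain'[OF _ T']) (use \<sigma> in \<open>auto intro!: derivative_eq_intros\<close>)
  show ?thesis unfolding plateau_def[abs_def]
    by (rule DERIV_cong[OF DERIV_cdivide[OF DERIV_diff[OF 1 2]]]) (use \<sigma> in \<open>simp add: field_simps\<close>)
qed

lemma plateau_eq_1: "\<bar>t\<bar> \<le> r \<Longrightarrow> plateau T r \<sigma> 0 t = 1"
  using T \<sigma> by (auto simp: plateau_def smooth_step_def divide_le_0_iff le_divide_eq)

lemma plateau_nonneg: "plateau T r \<sigma> 0 t \<ge> 0"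
proof (cases "t \<le> r")
  case True
  hence "T 0 ((t - r) / \<sigma>) = 0" using T \<sigma> by (auto simp: smooth_step_def divide_le_0_iff)
  thus ?thesis using T by (auto simp: plateau_def smooth_step_def)
next
  case False
  hence "T 0 ((t + r + \<sigma>) / \<sigma>) = 1" using T \<sigma> r by (auto simp: smooth_step_def le_divide_eq)
  thus ?thesis using T by (auto simp: plateau_def smooth_step_def)
qed

lemma plateau_le_1: "plateau T r \<sigma> 0 t \<le> 1"
  using T by (simp add: plateau_def smooth_step_def) (smt (verit))

lemma plateau_eq_0: "\<bar>t\<bar> > r + \<sigma> \<Longrightarrow> plateau T r \<sigma> k t = 0"
proof -
  assume t: "\<bar>t\<bar> > r + \<sigma>"
  consider "(t + r + \<sigma>) / \<sigma> \<le> 0" "(t - r) / \<sigma> \<le> 0" | "(t + r + \<sigma>) / \<sigma> \<ge> 1" "(t - r) / \<sigma> \<ge> 1"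
    using t r \<sigma> by (cases "t \<ge> 0") (auto simp: divide_le_0_iff le_divide_eq)
  thus ?thesis
    using T by cases (cases k; auto simp: plateau_def smooth_step_def)+
qed

lemma plateau_bound:
  assumes "\<And>t. \<bar>T k t\<bar> \<le> C"
  shows "\<bar>plateau T r \<sigma> k t\<bar> \<le> 2 * C / \<sigma> ^ k"
proof -
  have "\<bar>T k ((t + r + \<sigma>) / \<sigma>) - T k ((t - r) / \<sigma>)\<bar> \<le> 2 * C"
    using assms[of "(t + r + \<sigma>) / \<sigma>"] assms[of "(t - r) / \<sigma>"] by linarith
  thus ?thesis using \<sigma> by (simp add: plateau_def divide_right_mono)
qed

end

text \<open>Cubes are used instead of balls because the cutoff is then a product of functions of one
  coordinate each, whose mixed derivatives are explicit and independent of the order of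
  differentiation.\<close>

lemma iter_partial_prod:
  fixes \<psi> :: "nat \<Rightarrow> real \<Rightarrow> real"
  assumes "\<And>k t. (\<psi> k has_real_derivative \<psi> (Suc k) t) (at t)"
  shows "iter_partial is (\<lambda>x::real^'n::finite. \<Prod>i\<in>UNIV. \<psi> 0 (x $ i))
           = (\<lambda>x. \<Prod>i\<in>UNIV. \<psi> (count_list is i) (x $ i))"
    and "((\<lambda>t. iter_partial is (\<lambda>x::real^'n::finite. \<Prod>i\<in>UNIV. \<psi> 0 (x $ i)) (x + t *\<^sub>R axis j 1))
            has_real_derivative (\<Prod>i\<in>UNIV. \<psi> (count_list (j # is) i) (x $ i))) (at 0)"
proof -
  have d: "((\<lambda>t. \<Prod>i\<in>UNIV. \<psi> (count_list is i) ((x + t *\<^sub>R axis j 1) $ i)) has_real_derivative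
        (\<Prod>i\<in>UNIV. \<psi> (count_list (j # is) i) (x $ i))) (at 0)" for x :: "real^'n" and j "is"
  proof -
    have eq: "(\<Prod>i\<in>UNIV. \<psi> (count_list is i) ((x + t *\<^sub>R axis j 1) $ i)) =
       \<psi> (count_list is j) (x $ j + t) * (\<Prod>i\<in>UNIV-{j}. \<psi> (count_list is i) (x $ i))" for t
      by (subst prod.remove[of _ j]) (auto simp: axis_def intro!: prod.cong)
    have "(\<Prod>i\<in>UNIV. \<psi> (count_list (j # is) i) (x $ i)) =
       \<psi> (Suc (count_list is j)) (x $ j + 0) * (\<Prod>i\<in>UNIV-{j}. \<psi> (count_list is i) (x $ i))"
      by (subst prod.remove[of _ j]) (auto intro!: prod.cong)
    moreover have "((\<lambda>t. \<psi> (count_list is j) (x $ j + t)) has_real_derivative \<psi> (Suc (count_list is j)) (x $ j + 0)) (at 0)"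
      using assms[of "count_list is j" "x $ j + 0"] by (simp add: DERIV_shift[symmetric] add.commute)
    ultimately show ?thesis unfolding eq by (simp add: DERIV_cmult_right)
  qed
  show 1: "iter_partial is (\<lambda>x::real^'n::finite. \<Prod>i\<in>UNIV. \<psi> 0 (x $ i))
           = (\<lambda>x. \<Prod>i\<in>UNIV. \<psi> (count_list is i) (x $ i))" for "is"
  proof (induction "is")
    case (Cons j "is")
    show ?case
      unfolding iter_partial.simps Cons.IH partial_deriv_def using d[THEN DERIV_imp_deriv] by blast
  qed simp
  show "((\<lambda>t. iter_partial is (\<lambda>x::real^'n::finite. \<Prod>i\<in>UNIV. \<psi> 0 (x $ i)) (x + t *\<^sub>R axis j 1))
            has_real_derivative (\<Prod>i\<in>UNIV. \<psi> (count_list (j # is) i) (x $ i))) (at 0)"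
    unfolding 1 by (rule d)
qed

text \<open>The closed cube with centre $0$ and half side $r$.\<close>

definition cube :: "real \<Rightarrow> (real^'n::finite) set" where
  "cube r = cbox (vec (- r)) (vec r)"

lemma mem_cube: "x \<in> cube r \<longleftrightarrow> (\<forall>i. \<bar>x $ i\<bar> \<le> r)"
  by (auto simp: cube_def mem_box_cart abs_le_iff minus_le_iff)

text \<open>The point is the scaling: the constant $K$ does not depend on $r$ and $\sigma$.\<close>

lemma ex_cutoff:
  "\<exists>K>0. \<forall>r\<ge>0. \<forall>\<sigma>>0. \<exists>\<phi>::real^'n::finite \<Rightarrow> real. C_infinity_compact \<phi> \<and> continuous_on UNIV \<phi> \<and>
     (\<forall>x. 0 \<le> \<phi> x \<and> \<phi> x \<le> indicator (cube (r + \<sigma>)) x) \<and> (\<forall>x\<in>cube r. \<phi> x = 1) \<and>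
     (\<forall>\<alpha>\<in>multi_indices m. \<forall>x. \<bar>multi_deriv \<alpha> \<phi> x\<bar> \<le> K / \<sigma> ^ m * indicator (cube (r + \<sigma>)) x)"
proof -
  obtain T where T: "smooth_step T" using ex_smooth_step by blast
  have "\<forall>k. \<exists>C. \<forall>t. \<bar>T k t\<bar> \<le> C" using T by (simp add: smooth_step_def)
  then obtain C where C: "\<And>k t. \<bar>T k t\<bar> \<le> C k" by metis
  define K where "K = 1 + (\<Sum>\<alpha>\<in>multi_indices m. \<Prod>i\<in>(UNIV::'n set). 2 * C (\<alpha> i))"
  have Cn: "C k \<ge> 0" for k using C[of k 0] by auto
  hence Kn: "(\<Prod>i\<in>(UNIV::'n set). 2 * C (\<alpha> i)) \<ge> 0" for \<alpha> by (intro prod_nonneg) auto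
  have K0: "K > 0" using sum_nonneg[of "multi_indices m" "\<lambda>\<alpha>. \<Prod>i\<in>(UNIV::'n set). 2 * C (\<alpha> i)"] Kn
    by (simp add: K_def add_pos_nonneg)
  have Kge: "(\<Prod>i\<in>(UNIV::'n set). 2 * C (\<alpha> i)) \<le> K" if "\<alpha> \<in> multi_indices m" for \<alpha>
    using member_le_sum[OF that, of "\<lambda>\<alpha>. \<Prod>i\<in>(UNIV::'n set). 2 * C (\<alpha> i)"] Kn finite_multi_indices
    by (force simp: K_def)
  show ?thesis
  proof (intro exI[of _ K] conjI K0 allI impI)
    fix r \<sigma> :: real assume r: "r \<ge> 0" and \<sigma>: "\<sigma> > 0"
    note pl = plateau_has_derivative[OF T r \<sigma>] plateau_eq_1[OF T r \<sigma>] plateau_nonneg[OF T r \<sigma>]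
      plateau_le_1[OF T r \<sigma>] plateau_eq_0[OF T r \<sigma>] plateau_bound[OF T r \<sigma>]
    define \<psi> where "\<psi> = plateau T r \<sigma>"
    note pl = pl[folded \<psi>_def]
    define \<phi> where "\<phi> x = (\<Prod>i\<in>UNIV. \<psi> 0 (x $ i))" for x :: "real^'n"
    have ip: "iter_partial is \<phi> = (\<lambda>x. \<Prod>i\<in>UNIV. \<psi> (count_list is i) (x $ i))" for "is"
      unfolding \<phi>_def[abs_def] by (rule iter_partial_prod) (rule pl)
    have cont: "continuous_on UNIV (\<lambda>x::real^'n. \<Prod>i\<in>UNIV. \<psi> (k i) (x $ i))" for k
    proof (intro continuous_on_prod)
      fix i
      have "continuous_on UNIV (\<psi> (k i))" using pl(1) by (intro DERIV_continuous_on) 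
      thus "continuous_on UNIV (\<lambda>x::real^'n. \<psi> (k i) (x $ i))"
        by (rule continuous_on_compose2) (auto intro!: continuous_intros)
    qed
    have smooth: "C_infinity \<phi>"
      unfolding C_infinity_def
    proof (intro allI conjI)
      fix "is" show "continuous_on UNIV (iter_partial is \<phi>)" unfolding ip by (rule cont)
    next
      fix "is" i x show "(\<lambda>t. iter_partial is \<phi> (x + t *\<^sub>R axis i 1)) differentiable (at 0)"
        unfolding \<phi>_def[abs_def] using iter_partial_prod(2)[of \<psi>, OF pl(1)] real_differentiable_def by blast
    qed
    have z: "(\<Prod>i\<in>UNIV. \<psi> (k i) (x $ i)) = 0" if "x \<notin> cube (r + \<sigma>)" for k and x :: "real^'n"
      using that pl(5) by (fastforce simp: mem_cube not_le)
    have sub: "closure {x. \<phi> x \<noteq> 0} \<subseteq> cube (r + \<sigma>)"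
      by (rule closure_minimal) (use z[of _ "\<lambda>_. 0"] in \<open>auto simp: \<phi>_def cube_def\<close>)
    have "compact (cube (r + \<sigma>) \<inter> closure {x. \<phi> x \<noteq> 0})"
      by (intro compact_Int_closed) (auto simp: cube_def)
    hence "C_infinity_compact \<phi>" using smooth sub by (simp add: C_infinity_compact_def Int_absorb1)
    moreover have "continuous_on UNIV \<phi>" using ip[of "[]"] cont[of "\<lambda>_. 0"] by simp
    moreover have "0 \<le> \<phi> x" for x unfolding \<phi>_def by (intro prod_nonneg) (auto simp: pl(3))
    moreover have "\<phi> x \<le> indicator (cube (r + \<sigma>)) x" for x
      using z[of x "\<lambda>_. 0"] prod_le_1[of UNIV "\<lambda>i. \<psi> 0 (x $ i)"] pl(3,4)
      unfolding \<phi>_def by (cases "x \<in> cube (r + \<sigma>)") (simp_all del: prod_zero_iff)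
    moreover have "\<phi> x = 1" if "x \<in> cube r" for x using that pl(2) by (auto simp: \<phi>_def mem_cube)
    moreover have "\<bar>multi_deriv \<alpha> \<phi> x\<bar> \<le> K / \<sigma> ^ m * indicator (cube (r + \<sigma>)) x"
      if \<alpha>: "\<alpha> \<in> multi_indices m" for \<alpha> x
    proof -
      have eq: "multi_deriv \<alpha> \<phi> x = (\<Prod>i\<in>UNIV. \<psi> (\<alpha> i) (x $ i))"
        unfolding multi_deriv_def ip using someI_ex[OF ex_list_of_multi_index[of \<alpha>]] by simp
      have "\<bar>\<Prod>i\<in>UNIV. \<psi> (\<alpha> i) (x $ i)\<bar> \<le> (\<Prod>i\<in>UNIV. 2 * C (\<alpha> i) / \<sigma> ^ \<alpha> i)"
        unfolding abs_prod by (intro prod_mono conjI pl(6) C) auto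
      also have "\<dots> = (\<Prod>i\<in>UNIV. 2 * C (\<alpha> i)) / \<sigma> ^ m"
        using \<alpha> by (simp add: prod_dividef power_sum[symmetric] multi_indices_def)
      also have "\<dots> \<le> K / \<sigma> ^ m" using Kge[OF \<alpha>] \<sigma> by (simp add: divide_right_mono)
      finally show ?thesis using eq z[of x \<alpha>] by (cases "x \<in> cube (r + \<sigma>)") auto
    qed
    ultimately show "\<exists>\<phi>::real^'n \<Rightarrow> real. C_infinity_compact \<phi> \<and> continuous_on UNIV \<phi> \<and>
     (\<forall>x. 0 \<le> \<phi> x \<and> \<phi> x \<le> indicator (cube (r + \<sigma>)) x) \<and> (\<forall>x\<in>cube r. \<phi> x = 1) \<and>
     (\<forall>\<alpha>\<in>multi_indices m. \<forall>x. \<bar>multi_deriv \<alpha> \<phi> x\<bar> \<le> K / \<sigma> ^ m * indicator (cube (r + \<sigma>)) x)"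
      by blast
  qed
qed

section \<open>Lower bounds for the nonlinearities\<close>

lemma eventually_poly_le_power:
  fixes b C :: real
  assumes "b > 1"
  shows "\<forall>\<^sub>F k in sequentially. C * (1 + real k) ^ L \<le> b ^ k"
proof -
  have lb: "ln b > 0" using assms by simp
  define e where "e = (ln b) ^ L / (b * (\<bar>C\<bar> + 1))"
  have e: "e > 0" using lb assms by (simp add: e_def)
  have "filterlim (\<lambda>k. 1 + real k) at_top sequentially"
    by (intro filterlim_tendsto_add_at_top[OF tendsto_const] filterlim_real_sequentially)
  hence "filterlim (\<lambda>k. ln b * (1 + real k)) at_top sequentially"
    by (intro filterlim_tendsto_pos_mult_at_top[OF tendsto_const lb])
  hence "((\<lambda>k. (ln b * (1 + real k)) ^ L / exp (ln b * (1 + real k))) \<longlongrightarrow> 0) sequentially"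
    by (rule filterlim_compose[OF tendsto_power_div_exp_0])
  hence "\<forall>\<^sub>F k in sequentially. (ln b * (1 + real k)) ^ L / exp (ln b * (1 + real k)) < e"
    using e by (rule order_tendstoD)
  thus ?thesis
  proof eventually_elim
    case (elim k)
    have "exp (ln b * (1 + real k)) = b powr (real (Suc k))" using assms by (simp add: powr_def mult.commute)
    also have "\<dots> = b * b ^ k" using assms by (subst powr_realpow) auto
    finally have ex: "exp (ln b * (1 + real k)) = b * b ^ k" .
    have "(ln b) ^ L * (1 + real k) ^ L < (ln b) ^ L / (b * (\<bar>C\<bar> + 1)) * (b * b ^ k)"
      using elim assms unfolding ex e_def by (simp add: pos_divide_less_eq power_mult_distrib)
    also have "\<dots> = (ln b) ^ L * (b ^ k / (\<bar>C\<bar> + 1))" using assms by simp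
    finally have "(1 + real k) ^ L < b ^ k / (\<bar>C\<bar> + 1)"
      using lb by (simp add: mult_less_cancel_left_pos del: times_divide_eq_right)
    hence "(\<bar>C\<bar> + 1) * (1 + real k) ^ L < b ^ k" by (simp add: pos_less_divide_eq mult.commute)
    moreover have "C * (1 + real k) ^ L \<le> (\<bar>C\<bar> + 1) * (1 + real k) ^ L" by (intro mult_right_mono) auto
    ultimately show ?case by linarith
  qed
qed

lemma doubling_imp_poly_growth:
  fixes q :: "real \<Rightarrow> real"
  assumes mono: "\<And>s t. 0 \<le> s \<Longrightarrow> s \<le> t \<Longrightarrow> q s \<le> q t" and pos: "\<And>s. s \<ge> 0 \<Longrightarrow> q s > 0"
    and dbl: "\<And>s. s \<ge> 0 \<Longrightarrow> q (2 * s) \<le> C * q s"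
  shows "\<exists>D N. D > 0 \<and> (\<forall>s\<ge>0. q s \<le> D * (1 + s) ^ N)"
proof -
  obtain N where N: "C < 2 ^ N" using real_arch_pow[of 2 C] by auto
  have half: "q s \<le> 2 ^ N * q (s / 2)" if "s \<ge> 0" for s
    using dbl[of "s / 2"] mult_strict_right_mono[OF N pos[of "s / 2"]] that by simp
  have "\<forall>s. 1 \<le> s \<and> s \<le> 2 ^ k \<longrightarrow> q s \<le> q 1 * (2 * s) ^ N" for k :: nat
  proof (induction k)
    case 0
    have "q 1 \<le> q 1 * 2 ^ N" using pos[of 1] by simp
    thus ?case by auto
  next
    case (Suc k)
    show ?case
    proof (intro allI impI)
      fix s :: real assume s: "1 \<le> s \<and> s \<le> 2 ^ Suc k"
      have "q (s / 2) \<le> q 1 * s ^ N"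
      proof (cases "s \<le> 2")
        case True
        have "q (s / 2) \<le> q 1" using mono[of "s / 2" 1] s True by simp
        also have "q 1 \<le> q 1 * s ^ N" using pos[of 1] s by simp
        finally show ?thesis .
      next
        case False
        have "q (s / 2) \<le> q 1 * (2 * (s / 2)) ^ N" using Suc.IH[rule_format, of "s / 2"] s False by simp
        thus ?thesis by simp
      qed
      hence "2 ^ N * q (s / 2) \<le> 2 ^ N * (q 1 * s ^ N)" by (intro mult_left_mono) auto
      hence "q s \<le> 2 ^ N * (q 1 * s ^ N)" using half[of s] s by linarith
      thus "q s \<le> q 1 * (2 * s) ^ N" by (simp add: power_mult_distrib mult_ac)
    qed
  qed
  hence large: "q s \<le> q 1 * (2 * s) ^ N" if "s \<ge> 1" for s
    using real_arch_pow[of 2 s] that by (meson less_imp_le one_less_numeral_iff semiring_norm(76))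
  show ?thesis
  proof (intro exI[of _ "q 1 * 2 ^ N"] exI[of _ N] conjI allI impI)
    show "q 1 * 2 ^ N > 0" using pos[of 1] by simp
    fix s :: real assume s: "s \<ge> 0"
    show "q s \<le> q 1 * 2 ^ N * (1 + s) ^ N"
    proof (cases "s \<ge> 1")
      case True
      have "s ^ N \<le> (1 + s) ^ N" using s by (intro power_mono) auto
      hence "q 1 * 2 ^ N * s ^ N \<le> q 1 * 2 ^ N * (1 + s) ^ N" using pos[of 1] by simp
      thus ?thesis using large[OF True] by (simp add: power_mult_distrib mult_ac)
    next
      case False
      have "1 \<le> (2 * (1 + s)) ^ N" using s by (intro one_le_power) auto
      hence "q 1 * 1 \<le> q 1 * (2 * (1 + s)) ^ N" using pos[of 1] by (intro mult_left_mono) auto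
      moreover have "q s \<le> q 1" using False s mono[of s 1] by simp
      ultimately show ?thesis by (simp only: power_mult_distrib mult.assoc mult_1_right) 
    qed
  qed
qed

text \<open>For $\zeta \ge 1$ the function $f$ is at least $\zeta G(\zeta)$ with $G$ non-decreasing and
  slowly varying in the sense that $G(\sqrt\zeta) \ge c\,G(\zeta)$. Of the regularity conditions on
  $g$ only this one, with exponent $1/2$, is needed.\<close>

definition lower_bound_at_infinity :: "(real \<Rightarrow> real) \<Rightarrow> (real \<Rightarrow> real) \<Rightarrow> real \<Rightarrow> bool" where
  "lower_bound_at_infinity f G c \<longleftrightarrow> (\<forall>\<zeta>\<ge>1. G \<zeta> > 0 \<and> \<zeta> * G \<zeta> \<le> f \<zeta>) \<and>
     (\<forall>\<zeta> \<xi>. 1 \<le> \<zeta> \<longrightarrow> \<zeta> \<le> \<xi> \<longrightarrow> G \<zeta> \<le> G \<xi>) \<and> c > 0 \<and> (\<forall>\<zeta>\<ge>1. c * G \<zeta> \<le> G (sqrt \<zeta>))"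

text \<open>Up to a power of the logarithm, $f$ is at least linear near zero. The bound is stated
  uniformly for all $\zeta \ge e^{-s}$, large values included, so that it can be used along a whole
  run of doublings that starts at $e^{-s}$.\<close>

definition lower_bound_near_0 :: "(real \<Rightarrow> real) \<Rightarrow> real \<Rightarrow> nat \<Rightarrow> bool" where
  "lower_bound_near_0 f D N \<longleftrightarrow> D > 0 \<and> (\<forall>s\<ge>0. \<forall>\<zeta>\<ge>exp (- s). \<zeta> \<le> D * (1 + s) ^ N * f \<zeta>)"

lemma lower_bound_near_0_imp_pos:
  assumes "lower_bound_near_0 f D N" and z: "\<zeta> > 0"
  shows "f \<zeta> > 0"
proof -
  define s where "s = \<bar>ln \<zeta>\<bar>"
  have "exp (- s) \<le> exp (ln \<zeta>)" by (simp add: s_def)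
  hence "\<zeta> \<le> D * (1 + s) ^ N * f \<zeta>" "D > 0"
    using assms(1) z by (auto simp: lower_bound_near_0_def s_def)
  moreover from this have "D * (1 + s) ^ N > 0" by (simp add: s_def add_pos_nonneg)
  ultimately show ?thesis using z by (meson less_le_trans zero_less_mult_pos)
qed

text \<open>In the variable $s = \ln\zeta$ slow variation is a doubling condition.\<close>

lemma lower_bound_at_infinity_poly_log:
  assumes "lower_bound_at_infinity f G c"
  shows "\<exists>D N. D > 0 \<and> (\<forall>k::nat. G (2 ^ k) \<le> D * (1 + real k) ^ N)"
proof -
  have pos: "\<And>\<zeta>. \<zeta> \<ge> 1 \<Longrightarrow> G \<zeta> > 0" and mono: "\<And>\<zeta> \<xi>. 1 \<le> \<zeta> \<Longrightarrow> \<zeta> \<le> \<xi> \<Longrightarrow> G \<zeta> \<le> G \<xi>"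
    and c: "c > 0" and reg: "\<And>\<zeta>. \<zeta> \<ge> 1 \<Longrightarrow> c * G \<zeta> \<le> G (sqrt \<zeta>)"
    using assms by (auto simp: lower_bound_at_infinity_def)
  have "\<exists>D N. D > 0 \<and> (\<forall>s\<ge>0. G (exp s) \<le> D * (1 + s) ^ N)"
  proof (rule doubling_imp_poly_growth[of _ "1 / c"])
    fix s :: real assume s: "s \<ge> 0"
    have "sqrt (exp (2 * s)) = exp s" by (simp add: exp_double)
    thus "G (exp (2 * s)) \<le> 1 / c * G (exp s)" using reg[of "exp (2 * s)"] s c by (simp add: field_simps)
  qed (use pos mono in auto)
  then obtain D N where D: "D > 0" "\<And>s. s \<ge> 0 \<Longrightarrow> G (exp s) \<le> D * (1 + s) ^ N" by blast
  have "G (2 ^ k) \<le> D * (1 + real k) ^ N" for k :: nat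
  proof -
    have "(2::real) ^ k \<le> exp 1 ^ k" using exp_ge_add_one_self[of 1] by (intro power_mono) auto
    hence "G (2 ^ k) \<le> G (exp (real k))" by (intro mono) (auto simp flip: exp_of_nat_mult)
    thus ?thesis using D(2)[of "real k"] by simp
  qed
  thus ?thesis using D(1) by blast
qed

lemma Liminf_pos_imp:
  fixes F :: "'a \<Rightarrow> real"
  assumes "Liminf A (\<lambda>x. ereal (F x)) > 0"
  obtains c where "c > 0" "\<forall>\<^sub>F x in A. F x > c"
proof -
  obtain c where c: "ereal 0 < ereal c" "ereal c < Liminf A (\<lambda>x. ereal (F x))"
    using ereal_dense2[of 0 "Liminf A (\<lambda>x. ereal (F x))"] assms by (metis zero_ereal_def)
  have "\<forall>\<^sub>F x in A. ereal c < ereal (F x)" using c(2) by (rule less_LiminfD)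
  thus ?thesis using c(1) by (intro that[of c]) auto
qed

lemma nonlinearity_lower_bound_near_0:
  assumes "nonlinearity f lam 1 g h"
  shows "\<exists>D N. lower_bound_near_0 f D N"
proof -
  have hpos: "\<And>\<zeta>. 0 < \<zeta> \<Longrightarrow> \<zeta> \<le> 1 \<Longrightarrow> h \<zeta> > 0" and g1: "g 1 > 0" and lam: "lam \<ge> 1"
    and hmono: "\<And>\<zeta> \<xi>. 0 < \<zeta> \<Longrightarrow> \<zeta> \<le> \<xi> \<Longrightarrow> \<xi> \<le> 1 \<Longrightarrow> h \<zeta> \<le> h \<xi>"
    and gmono: "\<And>\<zeta>. 1 \<le> \<zeta> \<Longrightarrow> g 1 \<le> g \<zeta>"
    and fh: "\<And>\<zeta>. 0 < \<zeta> \<Longrightarrow> \<zeta> \<le> 1 \<Longrightarrow> f \<zeta> \<ge> \<zeta> * h \<zeta>"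
    and fg: "\<And>\<zeta>. 1 \<le> \<zeta> \<Longrightarrow> f \<zeta> \<ge> \<zeta> powr lam * g \<zeta>"
    and f0: "\<And>\<zeta>. 0 \<le> \<zeta> \<Longrightarrow> f \<zeta> \<ge> 0"
    and lim: "Liminf (at_right 0) (\<lambda>\<zeta>. ereal (h \<zeta> / h (\<zeta> powr (1/2)))) > 0"
    using assms by (auto simp: nonlinearity_def mono_on_def)
  obtain c where c: "c > 0" "\<forall>\<^sub>F \<zeta> in at_right 0. h \<zeta> / h (\<zeta> powr (1/2)) > c"
    using Liminf_pos_imp[OF lim] by blast
  then obtain d where d: "d > 0" "\<And>\<zeta>. 0 < \<zeta> \<Longrightarrow> \<zeta> < d \<Longrightarrow> h \<zeta> / h (\<zeta> powr (1/2)) > c"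
    by (auto simp: eventually_at_right_field)
  define d' where "d' = min d 1"
  define c' where "c' = min c (h d' / h 1)"
  have d': "0 < d'" "d' \<le> 1" "d' \<le> d" using d by (auto simp: d'_def)
  have c': "c' > 0" using c d' hpos by (auto simp: c'_def)
  have reg: "c' * h (sqrt \<zeta>) \<le> h \<zeta>" if z: "0 < \<zeta>" "\<zeta> \<le> 1" for \<zeta>
  proof -
    have s: "0 < sqrt \<zeta>" "sqrt \<zeta> \<le> 1" using z by auto
    hence hs: "h (sqrt \<zeta>) > 0" by (intro hpos)
    show ?thesis
    proof (cases "\<zeta> < d'")
      case True
      hence "c * h (sqrt \<zeta>) \<le> h \<zeta>"
        using d(2)[of \<zeta>] d' z hs by (simp add: powr_half_sqrt field_simps)
      moreover have "c' * h (sqrt \<zeta>) \<le> c * h (sqrt \<zeta>)" using hs by (auto simp: c'_def)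
      ultimately show ?thesis by linarith
    next
      case False
      have "c' * h (sqrt \<zeta>) \<le> (h d' / h 1) * h 1"
        using hs hmono[of "sqrt \<zeta>" 1] s hpos[of d'] hpos[of 1] d' by (intro mult_mono) (auto simp: c'_def)
      also have "\<dots> = h d'" using hpos[of 1] by simp
      also have "\<dots> \<le> h \<zeta>" using False z d' by (intro hmono) auto
      finally show ?thesis .
    qed
  qed
  have "\<exists>D N. D > 0 \<and> (\<forall>s\<ge>0. 1 / h (exp (- s)) \<le> D * (1 + s) ^ N)"
  proof (rule doubling_imp_poly_growth[of _ "1 / c'"])
    fix s :: real assume s: "s \<ge> 0"
    have e: "exp (- (2 * s)) = (exp (- s))\<^sup>2" by (simp flip: exp_double)
    have "c' * h (exp (- s)) \<le> h (exp (- (2 * s)))"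
      using reg[of "exp (- (2 * s))"] s unfolding e by (simp add: power_le_one)
    thus "1 / h (exp (- (2 * s))) \<le> 1 / c' * (1 / h (exp (- s)))"
      using c' hpos[of "exp (- s)"] hpos[of "exp (- (2 * s))"] s by (simp add: field_simps)
  next
    fix s t :: real assume "0 \<le> s" "s \<le> t"
    thus "1 / h (exp (- s)) \<le> 1 / h (exp (- t))"
      using hmono[of "exp (- t)" "exp (- s)"] hpos[of "exp (- t)"] by (intro divide_left_mono) (auto intro!: mult_pos_pos hpos)
  qed (use hpos in auto)
  then obtain D N where D: "D > 0" "\<And>s. s \<ge> 0 \<Longrightarrow> 1 / h (exp (- s)) \<le> D * (1 + s) ^ N" by blast
  have "lower_bound_near_0 f (max D (1 / g 1)) N"
    unfolding lower_bound_near_0_def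
  proof (intro conjI allI impI)
    show "max D (1 / g 1) > 0" using D by simp
    fix s \<zeta> :: real assume s: "s \<ge> 0" and z: "exp (- s) \<le> \<zeta>"
    have z0: "\<zeta> > 0" using z by (meson exp_gt_zero less_le_trans)
    have fz: "f \<zeta> \<ge> 0" using f0 z0 by simp
    have one: "1 \<le> (1 + s) ^ N" using s by (intro one_le_power) auto
    show "\<zeta> \<le> max D (1 / g 1) * (1 + s) ^ N * f \<zeta>"
    proof (cases "\<zeta> \<ge> 1")
      case True
      have "\<zeta> * g 1 \<le> \<zeta> powr lam * g \<zeta>"
        using True lam g1 gmono[OF True] powr_mono[of 1 lam \<zeta>] by (intro mult_mono) auto
      hence "\<zeta> * g 1 \<le> f \<zeta>" using fg[OF True] by linarith
      hence "\<zeta> \<le> 1 / g 1 * 1 * f \<zeta>" using g1 by (simp add: field_simps)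
      also have "\<dots> \<le> max D (1 / g 1) * (1 + s) ^ N * f \<zeta>"
        using one g1 fz D(1) by (intro mult_right_mono mult_mono) auto
      finally show ?thesis .
    next
      case False
      have h0: "h (exp (- s)) > 0" using s by (intro hpos) auto
      have "\<zeta> * h (exp (- s)) \<le> \<zeta> * h \<zeta>" using z z0 False by (intro mult_left_mono hmono) auto
      hence "\<zeta> * h (exp (- s)) \<le> f \<zeta>" using fh[of \<zeta>] False z0 by linarith
      hence "\<zeta> \<le> 1 / h (exp (- s)) * f \<zeta>" using h0 by (simp add: field_simps)
      also have "\<dots> \<le> max D (1 / g 1) * (1 + s) ^ N * f \<zeta>"
        using D(2)[OF s] fz one by (intro mult_right_mono) (auto intro: order_trans mult_right_mono)
      finally show ?thesis .
    qed
  qed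
  thus ?thesis by blast
qed

lemma nonlinearity_lower_bound_at_infinity:
  assumes "nonlinearity f lam \<mu> g h"
  shows "\<exists>c. lower_bound_at_infinity f g c"
proof -
  have gpos: "\<And>\<zeta>. 1 \<le> \<zeta> \<Longrightarrow> g \<zeta> > 0" and lam: "lam \<ge> 1"
    and gmono: "\<And>\<zeta> \<xi>. 1 \<le> \<zeta> \<Longrightarrow> \<zeta> \<le> \<xi> \<Longrightarrow> g \<zeta> \<le> g \<xi>"
    and fg: "\<And>\<zeta>. 1 \<le> \<zeta> \<Longrightarrow> f \<zeta> \<ge> \<zeta> powr lam * g \<zeta>"
    and lim: "Liminf at_top (\<lambda>\<zeta>. ereal (g (\<zeta> powr (1/2)) / g \<zeta>)) > 0"
    using assms by (auto simp: nonlinearity_def mono_on_def)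
  obtain c where c: "c > 0" "\<forall>\<^sub>F \<zeta> in at_top. g (\<zeta> powr (1/2)) / g \<zeta> > c"
    using Liminf_pos_imp[OF lim] by blast
  then obtain d where d: "\<And>\<zeta>. d \<le> \<zeta> \<Longrightarrow> g (\<zeta> powr (1/2)) / g \<zeta> > c"
    by (auto simp: eventually_at_top_linorder)
  define d' where "d' = max d 1"
  define c' where "c' = min c (g 1 / g d')"
  have d': "1 \<le> d'" "d \<le> d'" by (auto simp: d'_def)
  have c': "c' > 0" using c d' gpos by (auto simp: c'_def)
  have "c' * g \<zeta> \<le> g (sqrt \<zeta>)" if z: "1 \<le> \<zeta>" for \<zeta>
  proof (cases "\<zeta> \<ge> d'")
    case True
    hence "c * g \<zeta> \<le> g (sqrt \<zeta>)"
      using d[of \<zeta>] d' z gpos[of \<zeta>] by (simp add: powr_half_sqrt field_simps)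
    moreover have "c' * g \<zeta> \<le> c * g \<zeta>" using gpos[of \<zeta>] z by (auto simp: c'_def)
    ultimately show ?thesis by linarith
  next
    case False
    have "c' * g \<zeta> \<le> (g 1 / g d') * g d'"
      using False z gmono[of \<zeta> d'] gpos[of \<zeta>] gpos[of 1] gpos[of d'] d' by (intro mult_mono) (auto simp: c'_def)
    also have "\<dots> = g 1" using gpos[of d'] d' by simp
    also have "\<dots> \<le> g (sqrt \<zeta>)" using z by (intro gmono) auto
    finally show ?thesis .
  qed
  moreover have "\<zeta> * g \<zeta> \<le> f \<zeta>" if z: "1 \<le> \<zeta>" for \<zeta>
  proof -
    have "\<zeta> * g \<zeta> \<le> \<zeta> powr lam * g \<zeta>"
      using z lam gpos[of \<zeta>] powr_mono[of 1 lam \<zeta>] by (intro mult_right_mono) auto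
    thus ?thesis using fg[OF z] by linarith
  qed
  ultimately have "lower_bound_at_infinity f g c'" using c' gpos gmono by (auto simp: lower_bound_at_infinity_def)
  thus ?thesis by blast
qed

lemma lower_bound_at_infinity_const:
  assumes "lower_bound_at_infinity f g c"
  shows "lower_bound_at_infinity f (\<lambda>_. g 1) 1"
proof -
  have "\<zeta> * g 1 \<le> f \<zeta>" if "1 \<le> \<zeta>" for \<zeta>
    using assms that mult_left_mono[of "g 1" "g \<zeta>" \<zeta>] unfolding lower_bound_at_infinity_def
    by (meson order.trans order_refl zero_le_one)
  thus ?thesis using assms by (auto simp: lower_bound_at_infinity_def)
qed

text \<open>For $\lambda > 1$ the factor $\zeta^{\lambda-1}$ can be traded for any power of the
  logarithm.\<close>

lemma nonlinearity_lower_bound_at_infinity_log: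
  assumes "nonlinearity f lam \<mu> g h" and "lam > 1" and N: "N \<ge> 1"
  shows "\<exists>a c. a > 0 \<and> lower_bound_at_infinity f (\<lambda>\<zeta>. a * (1 + ln \<zeta>) ^ N) c"
proof -
  have g1: "g 1 > 0" and gmono: "\<And>\<zeta>. 1 \<le> \<zeta> \<Longrightarrow> g 1 \<le> g \<zeta>"
    and fg: "\<And>\<zeta>. 1 \<le> \<zeta> \<Longrightarrow> f \<zeta> \<ge> \<zeta> powr lam * g \<zeta>"
    using assms(1) by (auto simp: nonlinearity_def mono_on_def)
  define e where "e = (lam - 1) / real N"
  have e: "e > 0" using assms by (simp add: e_def)
  define B where "B = (1 + 1 / e) ^ N"
  have B: "B > 0" using e by (simp add: B_def add_pos_pos)
  define a where "a = g 1 / B"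
  have a: "a > 0" using g1 B by (simp add: a_def)
  have "\<zeta> * (a * (1 + ln \<zeta>) ^ N) \<le> f \<zeta>" if z: "1 \<le> \<zeta>" for \<zeta>
  proof -
    have "1 + ln \<zeta> \<le> \<zeta> powr e + \<zeta> powr e / e"
      using ln_powr_bound[OF z e] ge_one_powr_ge_zero[OF z less_imp_le[OF e]] by linarith
    also have "\<dots> = \<zeta> powr e * (1 + 1 / e)" by (simp add: algebra_simps)
    finally have "(1 + ln \<zeta>) ^ N \<le> (\<zeta> powr e * (1 + 1 / e)) ^ N" using z by (intro power_mono) auto
    also have "\<dots> = \<zeta> powr (lam - 1) * B"
      using z N by (simp add: power_mult_distrib B_def powr_power e_def)
    finally have "\<zeta> * (a * (1 + ln \<zeta>) ^ N) \<le> \<zeta> * (a * (\<zeta> powr (lam - 1) * B))"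
      using z a by (intro mult_left_mono) auto
    also have "\<dots> = (\<zeta> powr 1 * \<zeta> powr (lam - 1)) * g 1" using z B by (simp add: a_def)
    also have "\<dots> = \<zeta> powr lam * g 1" by (simp only: powr_add[symmetric]) simp
    also have "\<dots> \<le> \<zeta> powr lam * g \<zeta>" using gmono[OF z] by (intro mult_left_mono) auto
    finally show ?thesis using fg[OF z] by linarith
  qed
  moreover have "(1/2) ^ N * (a * (1 + ln \<zeta>) ^ N) \<le> a * (1 + ln (sqrt \<zeta>)) ^ N" if z: "1 \<le> \<zeta>" for \<zeta>
  proof -
    have "(1/2 * (1 + ln \<zeta>)) ^ N \<le> (1 + ln (sqrt \<zeta>)) ^ N"
      using z by (intro power_mono) (auto simp: ln_sqrt)
    hence "a * (1/2 * (1 + ln \<zeta>)) ^ N \<le> a * (1 + ln (sqrt \<zeta>)) ^ N" using a by simp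
    thus ?thesis by (simp only: power_mult_distrib mult_ac)
  qed
  moreover have "a * (1 + ln \<zeta>) ^ N > 0" if "1 \<le> \<zeta>" for \<zeta>
    using a that by (intro mult_pos_pos zero_less_power) (auto intro: add_pos_nonneg)
  moreover have "a * (1 + ln \<zeta>) ^ N \<le> a * (1 + ln \<xi>) ^ N" if "1 \<le> \<zeta>" "\<zeta> \<le> \<xi>" for \<zeta> \<xi>
    using a that by (intro mult_left_mono power_mono) auto
  ultimately have "lower_bound_at_infinity f (\<lambda>\<zeta>. a * (1 + ln \<zeta>) ^ N) ((1/2) ^ N)"
    by (auto simp: lower_bound_at_infinity_def)
  thus ?thesis using a by blast
qed

text \<open>The power $2M$ of the logarithm is chosen so that the terms decay like $k^{-2}$.\<close>

lemma summable_log_weight: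
  assumes a: "a > 0" and M: "M \<ge> 1"
  shows "summable (\<lambda>k. (a * (1 + ln (2 ^ k)) ^ (2 * M)) powr (- 1 / real M))"
proof (rule summable_comparison_test')
  show "summable (\<lambda>k. a powr (- 1 / real M) * 4 * inverse (real (Suc k) ^ 2))"
    using inverse_power_summable[of 2, where 'a = real]
    by (intro summable_mult) (subst summable_Suc_iff[of "\<lambda>n. inverse (real n ^ 2)"], simp)
  fix k :: nat assume "k \<ge> 0"
  define L where "L = 1 + real k * ln 2"
  have l2: "ln (2::real) \<ge> 1 / 2" using ln_le_minus_one[of "1 / 2 :: real"] by (simp add: ln_div)
  have L: "L \<ge> real (Suc k) / 2"
    using mult_left_mono[OF l2, of "real k"] by (simp add: L_def field_simps)
  have L0: "L > 0" using L by (smt (verit) of_nat_0_less_iff zero_less_Suc half_gt_zero)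
  have "(L ^ (2 * M)) powr (- 1 / real M) = L powr (real (2 * M) * (- 1 / real M))"
    using L0 by (simp only: powr_realpow[symmetric] powr_powr)
  also have "real (2 * M) * (- 1 / real M) = - 2" using M by simp
  also have "L powr (- 2) = inverse (L ^ 2)" using L0 by (simp add: powr_minus powr_numeral)
  also have "\<dots> \<le> inverse ((real (Suc k) / 2) ^ 2)"
    using L by (intro le_imp_inverse_le power_mono) auto
  also have "\<dots> = 4 * inverse (real (Suc k) ^ 2)" by (simp add: power_divide inverse_eq_divide)
  finally have *: "(L ^ (2 * M)) powr (- 1 / real M) \<le> 4 * inverse (real (Suc k) ^ 2)" .
  have "(a * L ^ (2 * M)) powr (- 1 / real M) = a powr (- 1 / real M) * (L ^ (2 * M)) powr (- 1 / real M)"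
    by (rule powr_mult)
  also have "\<dots> \<le> a powr (- 1 / real M) * (4 * inverse (real (Suc k) ^ 2))"
    using * by (intro mult_left_mono) auto
  finally show "norm ((a * (1 + ln (2 ^ k)) ^ (2 * M)) powr (- 1 / real M))
      \<le> a powr (- 1 / real M) * 4 * inverse (real (Suc k) ^ 2)"
    by (simp add: L_def ln_realpow mult.assoc)
qed

text \<open>The integral test in the variable $\ln\zeta$. The integrand is only compared with
  step functions below it, so its measurability plays no role.\<close>

lemma integral_test_dyadic:
  fixes W :: "real \<Rightarrow> real"
  assumes W0: "\<And>\<zeta>. \<zeta> \<ge> 1 \<Longrightarrow> W \<zeta> \<ge> 0"
    and anti: "\<And>\<zeta> \<xi>. 1 \<le> \<zeta> \<Longrightarrow> \<zeta> \<le> \<xi> \<Longrightarrow> W \<xi> \<le> W \<zeta>"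
    and fin: "(\<integral>\<^sup>+\<zeta>\<in>{1..}. ennreal (W \<zeta> / \<zeta>) \<partial>lborel) < \<infinity>"
  shows "summable (\<lambda>k. W (2 ^ k))"
proof -
  define I where "I k = {(2::real) ^ k..<2 ^ Suc k}" for k :: nat
  define t where "t k = W (2 ^ Suc k) / 2 ^ Suc k" for k :: nat
  have Wp: "W (2 ^ k) \<ge> 0" for k :: nat by (intro W0) simp
  have le: "(\<Sum>k<n. ennreal (t k) * indicator (I k) \<zeta>) \<le> ennreal (W \<zeta> / \<zeta>) * indicator {1..} \<zeta>" for n \<zeta>
  proof (cases "\<exists>k<n. \<zeta> \<in> I k")
    case True
    then obtain k where k: "k < n" "\<zeta> \<in> I k" by blast
    have z: "1 \<le> \<zeta>" "2 ^ k \<le> \<zeta>" "\<zeta> < 2 ^ Suc k"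
      using k(2) order_trans[of "1::real" "2 ^ k" \<zeta>] by (auto simp: I_def)
    have disj: "\<zeta> \<notin> I j" if "j \<noteq> k" for j
    proof
      assume j: "\<zeta> \<in> I j"
      have "(2::real) ^ j < 2 ^ Suc k" "(2::real) ^ k < 2 ^ Suc j" using j z by (auto simp: I_def)
      hence "j < Suc k" "k < Suc j" by (simp_all only: power_strict_increasing_iff one_less_numeral_iff semiring_norm)
      thus False using that by simp
    qed
    have "(\<Sum>j<n. ennreal (t j) * indicator (I j) \<zeta>) = (\<Sum>j\<in>{k}. ennreal (t j) * indicator (I j) \<zeta>)"
      using k disj by (intro sum.mono_neutral_right) auto
    also have "\<dots> = ennreal (t k)" using k by simp
    also have "t k \<le> W \<zeta> / \<zeta>"
      unfolding t_def using z anti[of \<zeta> "2 ^ Suc k"] W0[of \<zeta>] by (intro frac_le) auto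
    finally show ?thesis using z by (simp add: ennreal_leI)
  next
    case False
    hence "(\<Sum>k<n. ennreal (t k) * indicator (I k) \<zeta>) = 0" by (intro sum.neutral) auto
    thus ?thesis by simp
  qed
  obtain B where B: "(\<integral>\<^sup>+\<zeta>\<in>{1..}. ennreal (W \<zeta> / \<zeta>) \<partial>lborel) = ennreal B" "B \<ge> 0"
    using fin by (cases "\<integral>\<^sup>+\<zeta>\<in>{1..}. ennreal (W \<zeta> / \<zeta>) \<partial>lborel") auto
  have "(\<Sum>k<n. W (2 ^ Suc k) / 2) \<le> B" for n
  proof -
    have "ennreal (\<Sum>k<n. W (2 ^ Suc k) / 2) = (\<Sum>k<n. ennreal (t k) * emeasure lborel (I k))"
      using Wp[of "Suc _"] by (subst sum_ennreal[symmetric]) (auto simp: I_def t_def simp flip: ennreal_mult intro!: sum.cong)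
    also have "\<dots> = (\<integral>\<^sup>+\<zeta>. (\<Sum>k<n. ennreal (t k) * indicator (I k) \<zeta>) \<partial>lborel)"
      by (subst nn_integral_sum) (auto simp: nn_integral_cmult_indicator I_def)
    also have "\<dots> \<le> ennreal B" unfolding B(1)[symmetric] by (intro nn_integral_mono le)
    finally show ?thesis using B(2) by simp
  qed
  hence "summable (\<lambda>k. W (2 ^ Suc k) / 2)"
    using Wp[of "Suc _"] by (intro summableI_nonneg_bounded[of _ B]) auto
  hence "summable (\<lambda>k. W (2 ^ Suc k))" by (simp add: summable_divide_iff)
  thus ?thesis by (subst (asm) summable_Suc_iff)
qed

text \<open>The exponents $\lambda_i$ are eliminated here: in all cases the nonlinearities are bounded
  below by $\zeta G_i(\zeta)$ with a summability condition of the form taken for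
  $\lambda_1 = \lambda_2 = 1$.\<close>

lemma ex_summable_lower_bounds:
  fixes m1 m2 :: nat
  assumes M: "m1 + m2 \<ge> 1"
    and nl1: "nonlinearity f1 lam1 \<mu>1 g1 h1" and nl2: "nonlinearity f2 lam2 \<mu>2 g2 h2"
    and fin: "(\<integral>\<^sup>+\<zeta>\<in>{1..}. ennreal
            ((\<zeta> powr (lam1 * lam2) * g1 \<zeta> * g2 \<zeta> powr lam1) powr (- 1 / (real m1 + lam1 * real m2))
              * \<zeta> powr (1 / (real m1 + lam1 * real m2) - 1)) \<partial>lborel) < \<infinity>"
  shows "\<exists>G1 c1 G2 c2. lower_bound_at_infinity f1 G1 c1 \<and> lower_bound_at_infinity f2 G2 c2 \<and>
           summable (\<lambda>k. (G1 (2 ^ k) * G2 (2 ^ k)) powr (- 1 / real (m1 + m2)))"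
proof -
  obtain c1 where c1: "lower_bound_at_infinity f1 g1 c1" using nonlinearity_lower_bound_at_infinity[OF nl1] by blast
  obtain c2 where c2: "lower_bound_at_infinity f2 g2 c2" using nonlinearity_lower_bound_at_infinity[OF nl2] by blast
  have pos: "g1 \<zeta> > 0" "g2 \<zeta> > 0" if "\<zeta> \<ge> 1" for \<zeta> using c1 c2 that by (auto simp: lower_bound_at_infinity_def)
  have lam: "lam1 \<ge> 1" "lam2 \<ge> 1" using nl1 nl2 by (auto simp: nonlinearity_def)
  \<comment> \<open>Only in the last case does the integral condition carry information.\<close>
  consider "lam1 > 1" | "lam2 > 1" | "lam1 = 1" "lam2 = 1" using lam by linarith
  thus ?thesis
  proof cases
    case 1
    then obtain a c where a: "a > 0" "lower_bound_at_infinity f1 (\<lambda>\<zeta>. a * (1 + ln \<zeta>) ^ (2 * (m1 + m2))) c"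
      using nonlinearity_lower_bound_at_infinity_log[OF nl1, of "2 * (m1 + m2)"] M by auto
    moreover have "summable (\<lambda>k. (a * (1 + ln (2 ^ k)) ^ (2 * (m1 + m2)) * g2 1) powr (- 1 / real (m1 + m2)))"
      using summable_log_weight[of "a * g2 1" "m1 + m2"] a pos[of 1] M by (simp add: mult_ac)
    ultimately show ?thesis using lower_bound_at_infinity_const[OF c2] by blast
  next
    case 2
    then obtain a c where a: "a > 0" "lower_bound_at_infinity f2 (\<lambda>\<zeta>. a * (1 + ln \<zeta>) ^ (2 * (m1 + m2))) c"
      using nonlinearity_lower_bound_at_infinity_log[OF nl2, of "2 * (m1 + m2)"] M by auto
    moreover have "summable (\<lambda>k. (g1 1 * (a * (1 + ln (2 ^ k)) ^ (2 * (m1 + m2)))) powr (- 1 / real (m1 + m2)))"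
      using summable_log_weight[of "g1 1 * a" "m1 + m2"] a pos[of 1] M by (simp add: mult_ac)
    ultimately show ?thesis using lower_bound_at_infinity_const[OF c1] by blast
  next
    case 3
    define W where "W \<zeta> = (g1 \<zeta> * g2 \<zeta>) powr (- 1 / real (m1 + m2))" for \<zeta>
    have W: "(\<zeta> powr (lam1 * lam2) * g1 \<zeta> * g2 \<zeta> powr lam1) powr (- 1 / (real m1 + lam1 * real m2))
              * \<zeta> powr (1 / (real m1 + lam1 * real m2) - 1) = W \<zeta> / \<zeta>" if z: "\<zeta> \<ge> 1" for \<zeta>
    proof -
      define e where "e = 1 / real (m1 + m2)"
      have "(\<zeta> * (g1 \<zeta> * g2 \<zeta>)) powr (- e) * \<zeta> powr (e - 1)
          = (g1 \<zeta> * g2 \<zeta>) powr (- e) * (\<zeta> powr (- e) * \<zeta> powr (e - 1))"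
        using z pos[OF z] by (subst powr_mult) auto
      also have "\<zeta> powr (- e) * \<zeta> powr (e - 1) = \<zeta> powr (- 1)" by (simp flip: powr_add)
      also have "\<dots> = 1 / \<zeta>" using z by (simp add: powr_minus_divide)
      finally show ?thesis using z pos[OF z] 3 by (simp add: W_def e_def mult.assoc)
    qed
    have "summable (\<lambda>k. W (2 ^ k))"
    proof (rule integral_test_dyadic)
      fix \<zeta> \<xi> :: real assume z: "1 \<le> \<zeta>" "\<zeta> \<le> \<xi>"
      have "g1 \<zeta> * g2 \<zeta> \<le> g1 \<xi> * g2 \<xi>"
        using c1 c2 z pos[of \<zeta>] pos[of \<xi>] by (intro mult_mono) (auto simp: lower_bound_at_infinity_def intro: less_imp_le)
      thus "W \<xi> \<le> W \<zeta>" using z pos[of \<zeta>] by (auto simp: W_def intro!: powr_mono2')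
    next
      have "(\<integral>\<^sup>+\<zeta>\<in>{1..}. ennreal (W \<zeta> / \<zeta>) \<partial>lborel) = (\<integral>\<^sup>+\<zeta>\<in>{1..}. ennreal
            ((\<zeta> powr (lam1 * lam2) * g1 \<zeta> * g2 \<zeta> powr lam1) powr (- 1 / (real m1 + lam1 * real m2))
              * \<zeta> powr (1 / (real m1 + lam1 * real m2) - 1)) \<partial>lborel)"
        using W by (intro nn_integral_cong) (auto simp: indicator_def)
      thus "(\<integral>\<^sup>+\<zeta>\<in>{1..}. ennreal (W \<zeta> / \<zeta>) \<partial>lborel) < \<infinity>" using fin by simp
    qed (auto simp: W_def)
    thus ?thesis using c1 c2 unfolding W_def by blast
  qed
qed

section \<open>Blow-up of the coupled growth inequalities\<close>

text \<open>A step length that doubles every value $\zeta \ge e^{-p}$, polynomial in $p$.\<close>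

lemma doubling_step_near_0:
  fixes m1 m2 :: nat
  assumes s1: "lower_bound_near_0 f1 D1 N1" and s2: "lower_bound_near_0 f2 D2 N2"
    and c: "c > 0" and m: "m1 \<ge> 1" "m2 \<ge> 1"
  shows "\<exists>K>0. \<forall>(p::nat) \<sigma>. \<forall>\<zeta>\<ge>exp (- real p). \<sigma> = K * (1 + real p) ^ (N1 + N2) \<longrightarrow>
           2 * \<zeta> \<le> f1 (c * \<sigma> ^ m2 * f2 (c * \<sigma> ^ m1 * \<zeta>))"
proof -
  have D: "D1 > 0" "D2 > 0" using s1 s2 by (auto simp: lower_bound_near_0_def)
  \<comment> \<open>The four entries ensure, in this order, \<open>\<sigma> \<ge> 1\<close>, that the argument of \<open>f2\<close> is at least \<open>\<zeta>\<close>,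
    that the argument of \<open>f1\<close> is at least \<open>\<zeta>\<close>, and the factor \<open>2\<close> in the conclusion.\<close>
  define K where "K = Max {1, 1 / c, D2 / c\<^sup>2, 2 * D1 * D2 / c\<^sup>2}"
  have K: "K \<ge> 1" "K \<ge> 1 / c" "K \<ge> D2 / c\<^sup>2" "K \<ge> 2 * D1 * D2 / c\<^sup>2" by (auto simp: K_def)
  have "2 * \<zeta> \<le> f1 (c * \<sigma> ^ m2 * f2 (c * \<sigma> ^ m1 * \<zeta>))"
    if z: "\<zeta> \<ge> exp (- real p)" and \<sigma>: "\<sigma> = K * (1 + real p) ^ (N1 + N2)" for p :: nat and \<sigma> \<zeta> :: real
  proof -
    have z0: "\<zeta> > 0" using z by (meson exp_gt_zero less_le_trans)
    define q1 q2 where "q1 = (1 + real p) ^ N1" and "q2 = (1 + real p) ^ N2"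
    have q: "q1 \<ge> 1" "q2 \<ge> 1" by (auto simp: q1_def q2_def)
    have \<sigma>q: "\<sigma> = K * (q1 * q2)" by (simp add: \<sigma> q1_def q2_def power_add)
    have qq: "q1 * q2 \<ge> 1" using q by (simp add: mult_ge1_I)
    have \<sigma>K: "\<sigma> \<ge> K" using qq K by (simp add: \<sigma>q)
    hence \<sigma>1: "\<sigma> \<ge> 1" using K by simp
    define x where "x = c * \<sigma> ^ m1 * \<zeta>"
    have "1 \<le> c * \<sigma>" using K(2) \<sigma>K c by (simp add: field_simps) (smt (verit) mult_right_mono)
    also have "c * \<sigma> \<le> c * \<sigma> ^ m1" using c self_le_power[of \<sigma> m1] \<sigma>1 m by simp
    finally have "\<zeta> \<le> x" using z0 by (simp add: x_def)
    hence "x \<le> D2 * q2 * f2 x" using s2 z unfolding lower_bound_near_0_def q2_def by force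
    define y where "y = c * \<sigma> ^ m2 * f2 x"
    have "c\<^sup>2 * \<sigma> * \<zeta> \<le> c\<^sup>2 * \<sigma> ^ (m1 + m2) * \<zeta>"
      using self_le_power[of \<sigma> "m1 + m2"] \<sigma>1 m c z0 by (intro mult_right_mono mult_left_mono) auto
    also have "\<dots> = c * \<sigma> ^ m2 * x" by (simp add: x_def power_add power2_eq_square)
    also have "\<dots> \<le> c * \<sigma> ^ m2 * (D2 * q2 * f2 x)"
      using \<open>x \<le> _\<close> c \<sigma>1 by (intro mult_left_mono) auto
    also have "\<dots> = q2 * (D2 * y)" by (simp add: y_def)
    finally have "q2 * (c\<^sup>2 * K * q1 * \<zeta>) \<le> q2 * (D2 * y)" by (simp add: \<sigma>q mult_ac)
    hence y: "c\<^sup>2 * K * q1 * \<zeta> \<le> D2 * y" using q by simp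
    have "D2 * \<zeta> \<le> c\<^sup>2 * K * q1 * \<zeta>"
    proof (intro mult_right_mono)
      have "D2 * 1 \<le> (c\<^sup>2 * K) * q1" using K(3) c q D by (intro mult_mono) (auto simp: field_simps)
      thus "D2 \<le> c\<^sup>2 * K * q1" by simp
    qed (use z0 in auto)
    hence "D2 * \<zeta> \<le> D2 * y" using y by linarith
    hence "\<zeta> \<le> y" using D by simp
    hence "y \<le> D1 * q1 * f1 y" using s1 z unfolding lower_bound_near_0_def q1_def by force
    hence "D2 * y \<le> D2 * (D1 * q1 * f1 y)" using D by simp
    moreover have "2 * D1 * D2 * (q1 * \<zeta>) \<le> c\<^sup>2 * K * (q1 * \<zeta>)"
      using K(4) c q z0 by (intro mult_right_mono) (auto simp: field_simps)
    ultimately have "(D1 * D2 * q1) * (2 * \<zeta>) \<le> (D1 * D2 * q1) * f1 y" using y by (simp add: mult_ac)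
    moreover have "D1 * D2 * q1 > 0" using D q by simp
    ultimately have "2 * \<zeta> \<le> f1 y" by (simp only: mult_le_cancel_left_pos)
    thus ?thesis by (simp only: y_def x_def)
  qed
  thus ?thesis using K(1) by (intro exI[of _ K]) auto
qed

text \<open>At a high level $2^k$ a multiple of $w_k$ is a sufficient step length. As $G_1$ and $G_2$ are
  polynomial in $k$ at $2^k$, the arguments of $f_1$ and $f_2$ stay above $\sqrt{2^k}$, where slow
  variation bounds the values of the $G_i$ below by those at $2^k$.\<close>

lemma doubling_step_at_infinity:
  fixes m1 m2 :: nat
  assumes l1: "lower_bound_at_infinity f1 G1 c1" and l2: "lower_bound_at_infinity f2 G2 c2"
    and c: "c > 0" and M: "m1 + m2 \<ge> 1"
    and w: "\<And>k. w k = (G1 (2 ^ k) * G2 (2 ^ k)) powr (- 1 / real (m1 + m2))"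
  shows "\<exists>K>0. \<exists>k0. \<forall>k\<ge>k0. \<forall>\<sigma>. \<sigma> = K * w k \<longrightarrow>
           2 * 2 ^ k \<le> f1 (c * \<sigma> ^ m2 * f2 (c * \<sigma> ^ m1 * 2 ^ k))"
proof -
  have cc: "c1 > 0" "c2 > 0" using l1 l2 by (auto simp: lower_bound_at_infinity_def)
  define K where "K = max 1 (2 / (c\<^sup>2 * c1 * c2))"
  have K: "K \<ge> 1" by (simp add: K_def)
  have KM: "2 \<le> c\<^sup>2 * c1 * c2 * K ^ (m1 + m2)"
  proof -
    have "2 / (c\<^sup>2 * c1 * c2) \<le> K ^ (m1 + m2)"
    proof -
      have "2 / (c\<^sup>2 * c1 * c2) \<le> K" by (simp add: K_def)
      also have "K \<le> K ^ (m1 + m2)" using M by (intro self_le_power K) linarith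
      finally show ?thesis .
    qed
    thus ?thesis using c cc by (simp add: pos_divide_le_eq mult_ac)
  qed
  have G: "G1 (2 ^ k) > 0" "G2 (2 ^ k) > 0" for k :: nat using l1 l2 by (auto simp: lower_bound_at_infinity_def)
  obtain E1 N1 where E1: "E1 > 0" "\<And>k::nat. G1 (2 ^ k) \<le> E1 * (1 + real k) ^ N1"
    using lower_bound_at_infinity_poly_log[OF l1] by blast
  obtain E2 N2 where E2: "E2 > 0" "\<And>k::nat. G2 (2 ^ k) \<le> E2 * (1 + real k) ^ N2"
    using lower_bound_at_infinity_poly_log[OF l2] by blast
  have s2: "sqrt 2 > (1::real)" by simp
  have ev1: "\<forall>\<^sub>F k in sequentially. (1 + E1 * E2) ^ m1 / c * (1 + real k) ^ ((N1 + N2) * m1) \<le> sqrt 2 ^ k"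
    by (rule eventually_poly_le_power[OF s2])
  have ev2: "\<forall>\<^sub>F k in sequentially. c1 / 2 * E1 * (1 + real k) ^ N1 \<le> sqrt 2 ^ k"
    by (rule eventually_poly_le_power[OF s2])
  have "\<forall>\<^sub>F k in sequentially. 2 * 2 ^ k \<le> f1 (c * (K * w k) ^ m2 * f2 (c * (K * w k) ^ m1 * 2 ^ k))"
    using ev1 ev2
  proof eventually_elim
    case (elim k)
    define P where "P = G1 (2 ^ k) * G2 (2 ^ k)"
    have P: "P > 0" using G by (simp add: P_def)
    define q where "q = (1 + real k) ^ (N1 + N2)"
    have q1: "q \<ge> 1" by (simp add: q_def)
    have two: "(2::real) ^ k = sqrt 2 ^ k * sqrt 2 ^ k" by (simp flip: power_mult_distrib)
    have sq: "sqrt (2 ^ k) = sqrt 2 ^ k" by (simp add: real_sqrt_power)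
    have sq1: "sqrt 2 ^ k \<ge> (1::real)" by simp
    have wM: "w k ^ (m1 + m2) = 1 / P"
    proof -
      have "w k ^ (m1 + m2) = P powr (real (m1 + m2) * (- 1 / real (m1 + m2)))"
        unfolding w P_def[symmetric] by (rule powr_power) (use P in simp)
      also have "real (m1 + m2) * (- 1 / real (m1 + m2)) = - 1" using M by simp
      finally have "w k ^ (m1 + m2) = P powr (- 1)" .
      thus ?thesis using P by (simp add: powr_minus_divide)
    qed
    have w0: "w k > 0" using G[of k] by (simp add: w)
    have wlow: "inverse (1 + P) \<le> w k"
    proof -
      have "inverse (1 + P) = (1 + P) powr (- 1)" using P by (simp add: powr_minus)
      also have "\<dots> \<le> (1 + P) powr (- 1 / real (m1 + m2))"
        using P M by (intro powr_mono) (auto simp: field_simps)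
      also have "\<dots> \<le> P powr (- 1 / real (m1 + m2))" using P M by (intro powr_mono2') auto
      finally show ?thesis by (simp add: w P_def)
    qed
    have "P \<le> (E1 * (1 + real k) ^ N1) * (E2 * (1 + real k) ^ N2)"
      unfolding P_def using G[of k] E1 E2 by (intro mult_mono) auto
    hence "P \<le> E1 * E2 * q" by (simp add: q_def power_add mult_ac)
    hence "1 + P \<le> (1 + E1 * E2) * q" using q1 by (simp add: algebra_simps)
    hence "(1 + P) ^ m1 \<le> ((1 + E1 * E2) * q) ^ m1" using P by (intro power_mono) auto
    also have "\<dots> = (1 + E1 * E2) ^ m1 * (1 + real k) ^ ((N1 + N2) * m1)"
      by (simp add: power_mult_distrib q_def power_mult)
    also have "\<dots> \<le> c * sqrt 2 ^ k" using elim(1) c by (simp add: field_simps)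
    finally have Pm: "(1 + P) ^ m1 \<le> c * sqrt 2 ^ k" .
    define x where "x = c * (K * w k) ^ m1 * 2 ^ k"
    have "1 * inverse (1 + P) \<le> K * w k" using wlow K w0 P by (intro mult_mono) auto
    hence "inverse (1 + P) ^ m1 \<le> (K * w k) ^ m1" using P by (intro power_mono) auto
    hence "c * inverse (1 + P) ^ m1 * 2 ^ k \<le> x" using c unfolding x_def by (intro mult_right_mono mult_left_mono) auto
    moreover have "sqrt 2 ^ k \<le> c * inverse (1 + P) ^ m1 * 2 ^ k"
    proof -
      have "1 \<le> c * inverse (1 + P) ^ m1 * sqrt 2 ^ k"
        using Pm P by (simp add: field_simps)
      hence "1 * sqrt 2 ^ k \<le> c * inverse (1 + P) ^ m1 * sqrt 2 ^ k * sqrt 2 ^ k" by (intro mult_right_mono) auto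
      thus ?thesis by (simp add: two mult.assoc)
    qed
    ultimately have x: "sqrt 2 ^ k \<le> x" by linarith
    hence x1: "x \<ge> 1" using sq1 by linarith
    hence x0: "x > 0" by linarith
    have "c2 * G2 (2 ^ k) \<le> G2 (sqrt 2 ^ k)" using l2 sq by (auto simp: lower_bound_at_infinity_def simp flip: sq)
    also have "\<dots> \<le> G2 x" using l2 x sq1 by (simp add: lower_bound_at_infinity_def)
    finally have G2x: "c2 * G2 (2 ^ k) \<le> G2 x" .
    have "x * (c2 * G2 (2 ^ k)) \<le> x * G2 x" using G2x x0 by (intro mult_left_mono) auto
    also have "\<dots> \<le> f2 x" using l2 x1 by (simp add: lower_bound_at_infinity_def)
    finally have f2x: "x * (c2 * G2 (2 ^ k)) \<le> f2 x" .
    define y where "y = c * (K * w k) ^ m2 * f2 x"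
    have "c * (K * w k) ^ m2 * (x * (c2 * G2 (2 ^ k))) \<le> y"
      unfolding y_def using f2x c K w0 by (intro mult_left_mono) auto
    also have "c * (K * w k) ^ m2 * (x * (c2 * G2 (2 ^ k))) =
        c\<^sup>2 * c2 * K ^ (m1 + m2) * w k ^ (m1 + m2) * G2 (2 ^ k) * 2 ^ k"
      by (simp add: x_def power_mult_distrib power_add power2_eq_square mult_ac)
    also have "\<dots> = c\<^sup>2 * c2 * K ^ (m1 + m2) * 2 ^ k / G1 (2 ^ k)"
      unfolding wM P_def using G[of k] by simp
    finally have y: "c\<^sup>2 * c2 * K ^ (m1 + m2) * 2 ^ k \<le> y * G1 (2 ^ k)"
      using G[of k] by (simp add: pos_divide_le_eq)
    have "2 * 2 ^ k \<le> c\<^sup>2 * c1 * c2 * K ^ (m1 + m2) * 2 ^ k"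
      using KM by (intro mult_right_mono) auto
    also have "\<dots> \<le> c1 * (y * G1 (2 ^ k))" using y cc by (simp add: mult_ac)
    finally have y2: "2 * 2 ^ k \<le> c1 * (y * G1 (2 ^ k))" .
    have "c1 / 2 * G1 (2 ^ k) \<le> c1 / 2 * (E1 * (1 + real k) ^ N1)" using E1(2)[of k] cc by (intro mult_left_mono) auto
    also have "\<dots> \<le> sqrt 2 ^ k" using elim(2) by (simp add: mult.assoc)
    finally have G1s: "c1 * G1 (2 ^ k) \<le> 2 * sqrt 2 ^ k" by simp
    have y0: "y > 0"
    proof (rule ccontr)
      assume "\<not> y > 0"
      hence "c1 * (y * G1 (2 ^ k)) \<le> 0" using cc G[of k] by (simp add: mult_le_0_iff)
      moreover have "(2::real) * 2 ^ k > 0" by simp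
      ultimately show False using y2 by linarith
    qed
    have "(2 * sqrt 2 ^ k) * sqrt 2 ^ k \<le> (c1 * G1 (2 ^ k)) * y" using y2 by (simp add: two mult_ac)
    also have "\<dots> \<le> (2 * sqrt 2 ^ k) * y" using G1s y0 by (intro mult_right_mono) auto
    finally have ys: "sqrt 2 ^ k \<le> y" by simp
    hence y1: "y \<ge> 1" using sq1 by linarith
    have "c1 * G1 (2 ^ k) \<le> G1 (sqrt 2 ^ k)" using l1 sq by (auto simp: lower_bound_at_infinity_def simp flip: sq)
    also have "\<dots> \<le> G1 y" using l1 ys sq1 by (simp add: lower_bound_at_infinity_def)
    finally have "y * (c1 * G1 (2 ^ k)) \<le> y * G1 y" using y0 by simp
    also have "\<dots> \<le> f1 y" using l1 y1 by (simp add: lower_bound_at_infinity_def)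
    finally show ?case using y2 by (simp add: y_def x_def mult_ac)
  qed
  then obtain k0 where "\<And>k. k \<ge> k0 \<Longrightarrow>
      2 * 2 ^ k \<le> f1 (c * (K * w k) ^ m2 * f2 (c * (K * w k) ^ m1 * 2 ^ k))"
    by (auto simp: eventually_sequentially)
  thus ?thesis using K by (intro exI[of _ K]) auto
qed

text \<open>The values of $j_1$ double from $Z_0 = 2^{k_0 - p}$ on: $p$ doublings of the first kind lead
  to $2^{k_0}$, those of the second kind follow. The radius $R$ is determined by $p$ through
  $a R^{-n} = Z_0$, so it is exponential in $p$, while the total length of the steps is polynomial
  in $p$.\<close>

lemma coupled_growth_blow_up:
  fixes f1 f2 j1 j2 :: "real \<Rightarrow> real" and m1 m2 n :: nat
  assumes mono1: "\<And>s t. 0 \<le> s \<Longrightarrow> s \<le> t \<Longrightarrow> f1 s \<le> f1 t"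
    and mono2: "\<And>s t. 0 \<le> s \<Longrightarrow> s \<le> t \<Longrightarrow> f2 s \<le> f2 t"
    and f2_nonneg: "\<And>s. 0 \<le> s \<Longrightarrow> f2 s \<ge> 0"
    and s1: "lower_bound_near_0 f1 D1 N1" and s2: "lower_bound_near_0 f2 D2 N2"
    and l1: "lower_bound_at_infinity f1 G1 c1" and l2: "lower_bound_at_infinity f2 G2 c2"
    and summ: "summable (\<lambda>k. (G1 (2 ^ k) * G2 (2 ^ k)) powr (- 1 / real (m1 + m2)))"
    and c: "c > 0" and m: "m1 \<ge> 1" "m2 \<ge> 1" and n: "n \<ge> 1"
    and step2: "\<And>r \<sigma>. 0 < \<sigma> \<Longrightarrow> \<sigma> \<le> r \<Longrightarrow> f2 (c * \<sigma> ^ m1 * j1 r) \<le> j2 (r + \<sigma>)"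
    and step1: "\<And>r \<sigma>. 0 < \<sigma> \<Longrightarrow> \<sigma> \<le> r \<Longrightarrow> f1 (c * \<sigma> ^ m2 * j2 r) \<le> j1 (r + \<sigma>)"
    and start: "a > 0" "\<And>r. r \<ge> r0 \<Longrightarrow> a \<le> j1 r * r ^ n"
    and bdd: "\<And>R. R > 0 \<Longrightarrow> \<exists>B. \<forall>r\<in>{R..2 * R}. j1 r \<le> B"
  shows False
proof -
  define w where "w k = (G1 (2 ^ k) * G2 (2 ^ k)) powr (- 1 / real (m1 + m2))" for k :: nat
  have w_nonneg: "w k \<ge> 0" for k by (simp add: w_def)
  have w_pos: "w k > 0" for k
  proof -
    have "(2::real) ^ k \<ge> 1" by simp
    hence "G1 (2 ^ k) > 0" "G2 (2 ^ k) > 0" using l1 l2 unfolding lower_bound_at_infinity_def by blast+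
    thus ?thesis by (simp add: w_def)
  qed
  obtain Ks where Ks: "Ks > 0" "\<And>(p::nat) \<sigma> \<zeta>. \<zeta> \<ge> exp (- real p) \<Longrightarrow> \<sigma> = Ks * (1 + real p) ^ (N1 + N2) \<Longrightarrow>
           2 * \<zeta> \<le> f1 (c * \<sigma> ^ m2 * f2 (c * \<sigma> ^ m1 * \<zeta>))"
    using doubling_step_near_0[OF s1 s2 c m] by blast
  obtain Kl k0 where Kl: "Kl > 0" "\<And>k \<sigma>. k \<ge> k0 \<Longrightarrow> \<sigma> = Kl * w k \<Longrightarrow>
           2 * 2 ^ k \<le> f1 (c * \<sigma> ^ m2 * f2 (c * \<sigma> ^ m1 * 2 ^ k))"
    using doubling_step_at_infinity[OF l1 l2 c _ w_def] m by auto
  have summ': "summable (\<lambda>i. Kl * w (k0 + i))"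
    using summ unfolding w_def[symmetric] by (intro summable_mult) (simp add: add.commute[of k0] summable_iff_shift)
  define S where "S = (\<Sum>i. Kl * w (k0 + i))"
  have S: "(\<Sum>i<k. Kl * w (k0 + i)) \<le> S" for k
    unfolding S_def using Kl(1) w_nonneg by (intro sum_le_suminf summ') auto
  have S0: "S \<ge> 0" using S[of 0] by simp
  define N where "N = N1 + N2"
  define \<sigma>0 where "\<sigma>0 p = Ks * (1 + real p) ^ N" for p :: nat
  have \<sigma>0_pos: "\<sigma>0 p > 0" for p using Ks(1) by (simp add: \<sigma>0_def add_pos_nonneg)
  define C where "C = 2 * Ks + 2 * S + \<bar>r0\<bar> + 1"
  have "\<forall>\<^sub>F p in sequentially. (2 ^ k0 / a * C ^ n) * (1 + real p) ^ ((N + 1) * n) \<le> 2 ^ p"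
    by (rule eventually_poly_le_power) simp
  then obtain p where p: "(2 ^ k0 / a * C ^ n) * (1 + real p) ^ ((N + 1) * n) \<le> 2 ^ p"
    by (auto simp: eventually_sequentially)
  \<comment> \<open>Chosen so that the lower bound \<open>a / R ^ n\<close> for \<open>j1 R\<close> is \<open>2 ^ k0 / 2 ^ p\<close>.\<close>
  define R where "R = root n (a * 2 ^ p / 2 ^ k0)"
  have Rn: "R ^ n = a * 2 ^ p / 2 ^ k0"
    using n start(1) by (auto simp: R_def intro!: real_root_pow_pos2)
  have "2 * (real p * \<sigma>0 p + S) + \<bar>r0\<bar> + 1 \<le> C * (1 + real p) ^ (N + 1)"
  proof -
    have "real p * \<sigma>0 p \<le> Ks * (1 + real p) ^ (N + 1)"
      using Ks(1) by (simp add: \<sigma>0_def algebra_simps)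
    moreover have "2 * S + \<bar>r0\<bar> + 1 \<le> (2 * S + \<bar>r0\<bar> + 1) * (1 + real p) ^ (N + 1)"
      using S0 mult_left_mono[of 1 "(1 + real p) ^ (N + 1)" "2 * S + \<bar>r0\<bar> + 1"] one_le_power[of "1 + real p" "N + 1"] by simp
    ultimately show ?thesis by (simp add: C_def distrib_right)
  qed
  also have "C * (1 + real p) ^ (N + 1) \<le> R"
  proof (rule power_le_imp_le_base)
    have "(C * (1 + real p) ^ (N + 1)) ^ Suc (n - 1) = C ^ n * (1 + real p) ^ ((N + 1) * n)"
    proof -
      have "Suc (n - 1) = n" using n by simp
      thus ?thesis by (simp only: power_mult_distrib power_mult)
    qed
    also have "\<dots> \<le> a * 2 ^ p / 2 ^ k0" using p start(1) by (simp add: field_simps)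
    also have "\<dots> = R ^ Suc (n - 1)" using Rn n by simp
    finally show "(C * (1 + real p) ^ (N + 1)) ^ Suc (n - 1) \<le> R ^ Suc (n - 1)" .
    show "0 \<le> R" using n start(1) by (simp add: R_def)
  qed
  finally have R_ge: "2 * (real p * \<sigma>0 p + S) + \<bar>r0\<bar> + 1 \<le> R" .
  have psp: "real p * \<sigma>0 p \<ge> 0" using \<sigma>0_pos[of p] by simp
  have "R > 0" "R \<ge> r0" using R_ge S0 psp abs_ge_self[of r0] by argo+
  note R = this
  define \<sigma> where "\<sigma> k = (if k < p then \<sigma>0 p else Kl * w (k0 + (k - p)))" for k
  have \<sigma>_pos: "\<sigma> k > 0" for k using \<sigma>0_pos Kl(1) w_pos by (simp add: \<sigma>_def)
  have sum_eq: "(\<Sum>i<p + k. \<sigma> i) = real p * \<sigma>0 p + (\<Sum>i<k. Kl * w (k0 + i))" for k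
    by (induction k) (auto simp: \<sigma>_def)
  have sum_le: "2 * (\<Sum>i<k. \<sigma> i) \<le> R" for k
  proof -
    have "(\<Sum>i<k. \<sigma> i) \<le> (\<Sum>i<p + k. \<sigma> i)"
      by (intro sum_mono2) (auto intro: less_imp_le \<sigma>_pos)
    thus ?thesis using sum_eq[of k] S[of k] R_ge abs_ge_zero[of r0] by argo
  qed
  define Z :: "nat \<Rightarrow> real" where "Z k = 2 ^ k * 2 ^ k0 / 2 ^ p" for k
  have Z_pos: "Z k > (0::real)" for k by (simp add: Z_def)
  have Z_step: "2 * Z k \<le> f1 (c * \<sigma> k ^ m2 * f2 (c * \<sigma> k ^ m1 * Z k))" for k
  proof (cases "k < p")
    case True
    have "exp (- real p) = inverse (exp 1 ^ p)" by (simp add: exp_minus flip: exp_of_nat_mult)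
    also have "\<dots> \<le> inverse (2 ^ p)"
      using exp_ge_add_one_self[of 1] by (intro le_imp_inverse_le power_mono) auto
    also have "\<dots> \<le> Z k"
      using mult_mono[of 1 "(2::real) ^ k" 1 "2 ^ k0"] by (simp add: Z_def divide_inverse)
    finally show ?thesis using Ks(2)[of p "Z k" "\<sigma> k"] True by (simp add: \<sigma>_def \<sigma>0_def N_def)
  next
    case False
    have "Z k = 2 ^ (k0 + (k - p))" using False by (simp add: Z_def power_add power_diff)
    thus ?thesis using Kl(2)[of "k0 + (k - p)" "\<sigma> k"] False by (simp add: \<sigma>_def)
  qed
  define r where "r k = R + 2 * (\<Sum>i<k. \<sigma> i)" for k
  have r_ge: "r k \<ge> R" for k
    using sum_nonneg[of "{..<k}" \<sigma>] \<sigma>_pos by (auto simp: r_def less_imp_le)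
  have j_ge: "Z k \<le> j1 (r k)" for k
  proof (induction k)
    case 0
    have "a \<le> j1 R * R ^ n" using start(2) R by simp
    hence "a / R ^ n \<le> j1 R" using R by (simp add: pos_divide_le_eq)
    moreover have "a / R ^ n = Z 0" using start(1) by (simp add: Rn Z_def)
    ultimately show ?case by (simp add: r_def)
  next
    case (Suc k)
    have s: "\<sigma> k \<le> R"
    proof -
      have "\<sigma> k \<le> (\<Sum>i<Suc k. \<sigma> i)" using sum_nonneg[of "{..<k}" \<sigma>] \<sigma>_pos by (auto simp: less_imp_le)
      thus ?thesis using sum_le[of "Suc k"] \<sigma>_pos[of k] by linarith
    qed
    have "f2 (c * \<sigma> k ^ m1 * Z k) \<le> f2 (c * \<sigma> k ^ m1 * j1 (r k))"
      using Suc.IH c \<sigma>_pos[of k] Z_pos[of k] by (intro mono2 mult_left_mono) auto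
    also have "\<dots> \<le> j2 (r k + \<sigma> k)" using s r_ge[of k] \<sigma>_pos[of k] by (intro step2) auto
    finally have 1: "f2 (c * \<sigma> k ^ m1 * Z k) \<le> j2 (r k + \<sigma> k)" .
    have "f1 (c * \<sigma> k ^ m2 * f2 (c * \<sigma> k ^ m1 * Z k)) \<le> f1 (c * \<sigma> k ^ m2 * j2 (r k + \<sigma> k))"
      using 1 c \<sigma>_pos[of k] Z_pos[of k] by (intro mono1 mult_left_mono mult_nonneg_nonneg f2_nonneg) auto
    also have "\<dots> \<le> j1 (r k + \<sigma> k + \<sigma> k)" using s r_ge[of k] \<sigma>_pos[of k] by (intro step1) auto
    also have "r k + \<sigma> k + \<sigma> k = r (Suc k)" by (simp add: r_def)
    finally show ?case using Z_step[of k] by (simp add: Z_def)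
  qed
  obtain B where B: "\<And>r. r \<in> {R..2 * R} \<Longrightarrow> j1 r \<le> B" using bdd[OF R(1)] by blast
  have "Z k \<le> B" for k
    using j_ge[of k] B[of "r k"] r_ge[of k] sum_le[of k] by (auto simp: r_def)
  moreover obtain k where "B * 2 ^ p / 2 ^ k0 < 2 ^ k" using real_arch_pow[of 2] by auto
  hence "B < Z k" by (simp add: Z_def field_simps)
  ultimately show False by (meson not_le)
qed

section \<open>Averages of solutions over cubes\<close>

text \<open>The function $f$ need not be integrable: its integral is then $0$ by convention. For this
  reason the measurability of the compositions $a_\alpha(x,u(x))$ is never needed.\<close>

lemma abs_integral_le_integral:
  fixes f g :: "'a \<Rightarrow> real"
  assumes g: "integrable M g" and le: "AE x in M. \<bar>f x\<bar> \<le> g x"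
  shows "\<bar>integral\<^sup>L M f\<bar> \<le> integral\<^sup>L M g"
proof (cases "integrable M f")
  case True
  have "\<bar>integral\<^sup>L M f\<bar> \<le> (\<integral>x. \<bar>f x\<bar> \<partial>M)" using integral_norm_bound[of M f] by simp
  also have "\<dots> \<le> integral\<^sup>L M g" using True g le by (intro integral_mono_AE) auto
  finally show ?thesis .
next
  case False
  have "AE x in M. 0 \<le> g x" using le by eventually_elim linarith
  hence "integral\<^sup>L M g \<ge> 0" by (rule integral_nonneg_AE)
  thus ?thesis using False by (simp add: not_integrable_integral_eq)
qed

lemma compact_cube: "compact (cube r)"
  by (simp add: cube_def)

lemma measure_cube:
  assumes "r \<ge> 0"
  shows "measure lebesgue (cube r :: (real^'n::finite) set) = (2 * r) ^ CARD('n)"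
proof -
  have "cbox (vec (- r)) (vec r) \<noteq> ({} :: (real^'n) set)"
    using assms by (auto simp: interval_ne_empty_cart)
  thus ?thesis by (simp add: cube_def content_cbox_cart)
qed

lemma cube_mono: "r \<le> s \<Longrightarrow> cube r \<subseteq> cube s"
  unfolding mem_cube[abs_def] subset_iff by (meson order_trans)

lemma L1_loc_cube: "L1_loc F \<Longrightarrow> set_integrable lebesgue (cube r) F"
  by (simp add: L1_loc_def compact_cube)

lemma cube_integral_mono:
  assumes "L1_loc F" "\<And>x. F x \<ge> 0" "r \<le> s"
  shows "(LINT x:cube r|lebesgue. F x) \<le> (LINT x:cube s|lebesgue. F x)"
  unfolding set_lebesgue_integral_def
  using L1_loc_cube[OF assms(1)] cube_mono[OF assms(3)] assms(2)
  by (intro integral_mono) (auto simp: set_integrable_def indicator_def)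

lemma cube_integral_nonneg:
  fixes F :: "real^'n::finite \<Rightarrow> real"
  assumes "\<And>x. F x \<ge> 0"
  shows "(LINT x:cube r|lebesgue. F x) \<ge> 0"
  unfolding set_lebesgue_integral_def using assms by (intro integral_nonneg_AE) auto

text \<open>At the end point $0$ of the domain, where convexity alone gives no supporting line,
  monotonicity provides the slope $0$.\<close>

lemma convex_mono_subgradient:
  fixes f :: "real \<Rightarrow> real"
  assumes cv: "convex_on {0..} f" and mono: "mono_on {0..} f" and e: "e \<ge> 0"
  shows "\<exists>s. \<forall>t\<ge>0. f e + s * (t - e) \<le> f t"
proof (cases "e = 0")
  case True
  thus ?thesis using mono by (intro exI[of _ 0]) (auto simp: mono_on_def)
next
  case False
  hence "e \<in> interior {0..}" using e by simp
  thus ?thesis using convex_le_Inf_differential[OF cv] by fastforce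
qed

lemma jensen_set_average:
  fixes f :: "real \<Rightarrow> real"
  assumes cv: "convex_on {0..} f" and mono: "mono_on {0..} f"
    and S: "S \<in> fmeasurable M" "measure M S > 0"
    and v: "\<And>x. v x \<ge> 0" "set_integrable M S v" "set_integrable M S (\<lambda>x. f (v x))"
  shows "f ((LINT x:S|M. v x) / measure M S) \<le> (LINT x:S|M. f (v x)) / measure M S"
proof -
  define e where "e = (LINT x:S|M. v x) / measure M S"
  have "(LINT x:S|M. v x) \<ge> 0"
    unfolding set_lebesgue_integral_def using v by (intro integral_nonneg_AE) auto
  hence e: "e \<ge> 0" using S by (simp add: e_def)
  obtain s where s: "\<And>t. t \<ge> 0 \<Longrightarrow> f e + s * (t - e) \<le> f t"
    using convex_mono_subgradient[OF cv mono e] by blast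
  have const: "set_integrable M S (\<lambda>x. k)" for k :: real
    using S(1) by (simp add: set_integrable_def fmeasurable_def)
  have "(LINT x:S|M. (f e - s * e) + s * v x) \<le> (LINT x:S|M. f (v x))"
    using s[OF v(1)] v const by (intro set_integral_mono set_integral_add set_integrable_mult_right) (auto simp: algebra_simps)
  also have "(LINT x:S|M. (f e - s * e) + s * v x) = (LINT x:S|M. f e - s * e) + s * (LINT x:S|M. v x)"
    using const v by (subst set_integral_add) auto
  also have "(LINT x:S|M. f e - s * e) = (f e - s * e) * measure M S"
    using S(1) by (simp add: set_lebesgue_integral_def fmeasurable_def mult.commute)
  also have "(LINT x:S|M. v x) = e * measure M S" using S by (simp add: e_def)
  finally have "f e * measure M S \<le> (LINT x:S|M. f (v x))" by (simp add: algebra_simps)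
  thus ?thesis unfolding e_def[symmetric] using S by (simp add: pos_le_divide_eq)
qed

lemma weak_ineq_cube_estimate:
  fixes u :: "real^'n::finite \<Rightarrow> real"
  assumes weak: "weak_ineq m a u F" and A: "A > 0"
    and bound: "\<And>\<alpha>. \<alpha> \<in> multi_indices m \<Longrightarrow> AE x in lebesgue. \<bar>a \<alpha> x (u x)\<bar> \<le> A * \<bar>u x\<bar>"
    and u: "L1_loc u" and F: "L1_loc F" "\<And>x. F x \<ge> 0"
  shows "\<exists>C>0. \<forall>r>0. \<forall>\<sigma>>0.
    (LINT x:cube r|lebesgue. F x) \<le> C / \<sigma> ^ m * (LINT x:cube (r + \<sigma>)|lebesgue. \<bar>u x\<bar>)"
proof -
  obtain K where K: "K > 0" "\<And>r \<sigma>. r \<ge> 0 \<Longrightarrow> \<sigma> > 0 \<Longrightarrow> \<exists>\<phi>::real^'n \<Rightarrow> real. C_infinity_compact \<phi> \<and> continuous_on UNIV \<phi> \<and>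
     (\<forall>x. 0 \<le> \<phi> x \<and> \<phi> x \<le> indicator (cube (r + \<sigma>)) x) \<and> (\<forall>x\<in>cube r. \<phi> x = 1) \<and>
     (\<forall>\<alpha>\<in>multi_indices m. \<forall>x. \<bar>multi_deriv \<alpha> \<phi> x\<bar> \<le> K / \<sigma> ^ m * indicator (cube (r + \<sigma>)) x)"
    using ex_cutoff[of m, where 'n = 'n] by blast
  define L where "L = real (card (multi_indices m :: ('n \<Rightarrow> nat) set)) + 1"
  have L: "L > 0" by (simp add: L_def add_nonneg_pos)
  have ua: "integrable lebesgue (\<lambda>x. indicator (cube s) x * \<bar>u x\<bar>)" for s
    using set_integrable_abs[OF L1_loc_cube[OF u]] by (simp add: set_integrable_def)
  have Fi: "integrable lebesgue (\<lambda>x. indicator (cube s) x * F x)" for s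
    using L1_loc_cube[OF F(1)] by (simp add: set_integrable_def)
  show ?thesis
  proof (intro exI[of _ "L * A * K"] conjI allI impI)
    show "L * A * K > 0" using L A K by simp
    fix r \<sigma> :: real assume r: "r > 0" and \<sigma>: "\<sigma> > 0"
    obtain \<phi> :: "real^'n \<Rightarrow> real" where \<phi>: "C_infinity_compact \<phi>" "continuous_on UNIV \<phi>"
      "\<And>x. 0 \<le> \<phi> x" "\<And>x. \<phi> x \<le> indicator (cube (r + \<sigma>)) x" "\<And>x. x \<in> cube r \<Longrightarrow> \<phi> x = 1"
      "\<And>\<alpha> x. \<alpha> \<in> multi_indices m \<Longrightarrow> \<bar>multi_deriv \<alpha> \<phi> x\<bar> \<le> K / \<sigma> ^ m * indicator (cube (r + \<sigma>)) x"
      using K(2)[of r \<sigma>] r \<sigma> by (auto simp: less_imp_le)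
    have \<phi>m: "\<phi> \<in> borel_measurable lebesgue"
      using \<phi>(2) by (intro measurable_completion) (simp add: borel_measurable_continuous_onI)
    have F\<phi>: "F x * \<phi> x = indicator (cube (r + \<sigma>)) x * F x * \<phi> x" for x
      using \<phi>(3)[of x] \<phi>(4)[of x] by (cases "x \<in> cube (r + \<sigma>)") auto
    have F\<phi>i: "integrable lebesgue (\<lambda>x. F x * \<phi> x)"
    proof (rule Bochner_Integration.integrable_bound[OF Fi[of "r + \<sigma>"]])
      show "(\<lambda>x. F x * \<phi> x) \<in> borel_measurable lebesgue"
        unfolding F\<phi> by (intro borel_measurable_times \<phi>m borel_measurable_integrable Fi)
      show "AE x in lebesgue. norm (F x * \<phi> x) \<le> norm (indicator (cube (r + \<sigma>)) x * F x)"
      proof (intro AE_I2)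
        fix x
        have "\<phi> x \<le> 1" using \<phi>(4)[of x] by (cases "x \<in> cube (r + \<sigma>)") auto
        thus "norm (F x * \<phi> x) \<le> norm (indicator (cube (r + \<sigma>)) x * F x)"
          unfolding F\<phi> using \<phi>(3)[of x] F(2)[of x] by (simp add: abs_mult mult_left_le)
      qed
    qed
    have "(LINT x:cube r|lebesgue. F x) \<le> (LINT x|lebesgue. F x * \<phi> x)"
      unfolding set_lebesgue_integral_def real_scaleR_def
      by (intro integral_mono Fi F\<phi>i) (use F(2) \<phi> in \<open>auto simp: indicator_def\<close>)
    also have "\<dots> \<le> (-1) ^ m * (LINT x|lebesgue. (\<Sum>\<alpha>\<in>multi_indices m. a \<alpha> x (u x) * multi_deriv \<alpha> \<phi> x))"
      using weak \<phi>(1,3) unfolding weak_ineq_def by blast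
    also have "\<dots> \<le> \<bar>LINT x|lebesgue. (\<Sum>\<alpha>\<in>multi_indices m. a \<alpha> x (u x) * multi_deriv \<alpha> \<phi> x)\<bar>"
      by (cases "even m") auto
    also have "\<dots> \<le> (LINT x|lebesgue. (L * A * K / \<sigma> ^ m) * (indicator (cube (r + \<sigma>)) x * \<bar>u x\<bar>))"
    proof (rule abs_integral_le_integral)
      have "AE x in lebesgue. \<forall>\<alpha>\<in>multi_indices m. \<bar>a \<alpha> x (u x)\<bar> \<le> A * \<bar>u x\<bar>"
        using bound by (intro AE_finite_allI finite_multi_indices) auto
      thus "AE x in lebesgue. \<bar>\<Sum>\<alpha>\<in>multi_indices m. a \<alpha> x (u x) * multi_deriv \<alpha> \<phi> x\<bar>
          \<le> (L * A * K / \<sigma> ^ m) * (indicator (cube (r + \<sigma>)) x * \<bar>u x\<bar>)"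
      proof eventually_elim
        case (elim x)
        define B where "B = (A * \<bar>u x\<bar>) * (K / \<sigma> ^ m * indicator (cube (r + \<sigma>)) x)"
        have B: "B \<ge> 0" using A K \<sigma> by (simp add: B_def)
        have "\<bar>\<Sum>\<alpha>\<in>multi_indices m. a \<alpha> x (u x) * multi_deriv \<alpha> \<phi> x\<bar>
            \<le> (\<Sum>\<alpha>\<in>(multi_indices m :: ('n \<Rightarrow> nat) set). B)"
          using elim \<phi>(6) A unfolding B_def
          by (intro order_trans[OF sum_abs] sum_mono) (auto simp only: abs_mult intro!: mult_mono)
        also have "\<dots> \<le> L * B" using B by (simp add: L_def algebra_simps)
        finally show ?case by (simp add: B_def mult_ac)
      qed
    qed (intro integrable_mult_right ua)
    also have "\<dots> = L * A * K / \<sigma> ^ m * (LINT x:cube (r + \<sigma>)|lebesgue. \<bar>u x\<bar>)"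
      by (simp add: set_lebesgue_integral_def)
    finally show "(LINT x:cube r|lebesgue. F x) \<le> L * A * K / \<sigma> ^ m * (LINT x:cube (r + \<sigma>)|lebesgue. \<bar>u x\<bar>)" .
  qed
qed

text \<open>The mean value over a cube; the denominator is the volume for $r > 0$.\<close>

definition cube_average :: "(real^'n::finite \<Rightarrow> real) \<Rightarrow> real \<Rightarrow> real" where
  "cube_average F r = (LINT x:cube r|lebesgue. F x) / (2 * r) ^ CARD('n)"

text \<open>The condition $\sigma \le r$ keeps the ratio of the volumes of the two cubes below $2^n$. The
  constant may be decreased at will, so that the two inequalities of a system can share one.\<close>

lemma cube_average_step:
  fixes u :: "real^'n::finite \<Rightarrow> real"
  assumes weak: "weak_ineq m a u F" and A: "A > 0"
    and bound: "\<And>\<alpha>. \<alpha> \<in> multi_indices m \<Longrightarrow> AE x in lebesgue. \<bar>a \<alpha> x (u x)\<bar> \<le> A * \<bar>u x\<bar>"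
    and u: "L1_loc u" and F: "L1_loc F" "\<And>x. F x \<ge> 0"
    and f: "convex_on {0..} f" "mono_on {0..} f" and fu: "L1_loc (\<lambda>x. f \<bar>u x\<bar>)"
  shows "\<exists>c0>0. \<forall>c r \<sigma>. 0 < c \<longrightarrow> c \<le> c0 \<longrightarrow> 0 < \<sigma> \<longrightarrow> \<sigma> \<le> r \<longrightarrow>
     f (c * \<sigma> ^ m * cube_average F r) \<le> cube_average (\<lambda>x. f \<bar>u x\<bar>) (r + \<sigma>)"
proof -
  obtain C where C: "C > 0" "\<And>r \<sigma>. r > 0 \<Longrightarrow> \<sigma> > 0 \<Longrightarrow>
    (LINT x:cube r|lebesgue. F x) \<le> C / \<sigma> ^ m * (LINT x:cube (r + \<sigma>)|lebesgue. \<bar>u x\<bar>)"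
    using weak_ineq_cube_estimate[OF weak A bound u F] by blast
  define n where "n = CARD('n)"
  show ?thesis
  proof (intro exI[of _ "1 / (C * 2 ^ n)"] conjI allI impI)
    show "1 / (C * 2 ^ n) > 0" using C(1) by simp
    fix c r \<sigma> :: real assume c: "0 < c" "c \<le> 1 / (C * 2 ^ n)" and \<sigma>: "0 < \<sigma>" "\<sigma> \<le> r"
    define J where "J = cube_average F r"
    define E where "E = (LINT x:cube (r + \<sigma>)|lebesgue. \<bar>u x\<bar>)"
    define e where "e = cube_average (\<lambda>x. \<bar>u x\<bar>) (r + \<sigma>)"
    have r: "r > 0" using \<sigma> by linarith
    have J0: "J \<ge> 0" using r cube_integral_nonneg[of F r] F by (simp add: J_def cube_average_def)
    have E0: "E \<ge> 0" unfolding E_def by (rule cube_integral_nonneg) simp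
    have eE: "E = e * (2 * (r + \<sigma>)) ^ n" using \<sigma> by (simp add: e_def E_def cube_average_def n_def)
    have e0: "e \<ge> 0" using E0 \<sigma> by (simp add: e_def E_def cube_average_def)
    have "J * (2 * r) ^ n \<le> C / \<sigma> ^ m * E"
      using C(2)[OF r \<sigma>(1)] r by (simp add: J_def E_def cube_average_def n_def)
    also have "\<dots> \<le> C / \<sigma> ^ m * (e * (2 * (2 * r)) ^ n)"
      unfolding eE using \<sigma> C(1) e0 by (intro mult_left_mono power_mono) auto
    also have "\<dots> = (C / \<sigma> ^ m * e * 2 ^ n) * (2 * r) ^ n" by (simp only: power_mult_distrib mult_ac)
    finally have "J * (2 * r) ^ n \<le> (C / \<sigma> ^ m * e * 2 ^ n) * (2 * r) ^ n" .
    moreover have "(2 * r) ^ n > 0" using r by simp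
    ultimately have "J \<le> C / \<sigma> ^ m * e * 2 ^ n" by (simp only: mult_le_cancel_right_pos)
    hence "\<sigma> ^ m * J \<le> C * 2 ^ n * e" using \<sigma> by (simp add: field_simps)
    hence "1 / (C * 2 ^ n) * (\<sigma> ^ m * J) \<le> e" using C(1) by (simp add: pos_divide_le_eq mult_ac)
    moreover have "c * (\<sigma> ^ m * J) \<le> 1 / (C * 2 ^ n) * (\<sigma> ^ m * J)"
      using c J0 \<sigma> by (intro mult_right_mono) auto
    ultimately have "c * \<sigma> ^ m * J \<le> e" by (simp add: mult.assoc)
    hence "f (c * \<sigma> ^ m * J) \<le> f e"
      using f(2) c \<sigma> J0 e0 by (auto simp: mono_on_def)
    also have "\<dots> \<le> cube_average (\<lambda>x. f \<bar>u x\<bar>) (r + \<sigma>)"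
    proof -
      have "r + \<sigma> > 0" using r \<sigma> by simp
      hence *: "measure lebesgue (cube (r + \<sigma>) :: (real^'n) set) = (2 * (r + \<sigma>)) ^ n"
        "(2 * (r + \<sigma>)) ^ n > 0"
        by (auto simp: measure_cube n_def)
      have "(cube (r + \<sigma>) :: (real^'n) set) \<in> lmeasurable" by (simp add: cube_def)
      from jensen_set_average[OF f this _ _ set_integrable_abs[OF L1_loc_cube[OF u]] L1_loc_cube[OF fu]] *
      show ?thesis by (simp add: e_def cube_average_def n_def)
    qed
    finally show "f (c * \<sigma> ^ m * cube_average F r) \<le> cube_average (\<lambda>x. f \<bar>u x\<bar>) (r + \<sigma>)"
      by (simp add: J_def)
  qed
qed

lemma AE_zero_of_cube_integrals:
  assumes F: "L1_loc F" "\<And>x. F x \<ge> 0" and zero: "\<And>r. r > 0 \<Longrightarrow> (LINT x:cube r|lebesgue. F x) \<le> 0"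
  shows "AE x in lebesgue. F (x :: real^'n::finite) = 0"
proof -
  have "AE x in lebesgue. indicator (cube (real (Suc k))) x * F x = 0" for k
  proof (subst integral_nonneg_eq_0_iff_AE[symmetric])
    show "integrable lebesgue (\<lambda>x. indicator (cube (real (Suc k))) x * F x)"
      using L1_loc_cube[OF F(1), of "real (Suc k)"] by (simp add: set_integrable_def)
    show "(LINT x|lebesgue. indicator (cube (real (Suc k))) x * F x) = 0"
      using antisym[OF zero[of "real (Suc k)"] cube_integral_nonneg[of F "real (Suc k)"]] F(2)
      by (simp add: set_lebesgue_integral_def)
  qed (use F in auto)
  hence "AE x in lebesgue. \<forall>k. indicator (cube (real (Suc k))) x * F x = 0" by (simp only: AE_all_countable) simp
  thus ?thesis
  proof eventually_elim
    case (elim x)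
    obtain k :: nat where k: "norm x \<le> real k" using real_arch_simple by blast
    have "\<bar>x $ i\<bar> \<le> real (Suc k)" for i using component_le_norm_cart[of x i] k by simp
    hence "x \<in> cube (real (Suc k))" by (simp add: mem_cube)
    thus ?case using elim by (metis indicator_simps(1) mult_1)
  qed
qed

lemma multi_indices_nonempty: "multi_indices m \<noteq> ({} :: ('n::finite \<Rightarrow> nat) set)"
proof -
  obtain i0 :: 'n where True by blast
  have "(\<lambda>i. if i = i0 then m else 0) \<in> multi_indices m" by (simp add: multi_indices_def)
  thus ?thesis by blast
qed

section \<open>Triviality of solutions\<close>

theorem theorem2p3:
  fixes m\<^sub>1 m\<^sub>2 :: nat
    and a b :: "('n::finite \<Rightarrow> nat) \<Rightarrow> real^'n \<Rightarrow> real \<Rightarrow> real"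
    and A lam\<^sub>1 lam\<^sub>2 \<mu>\<^sub>1 \<mu>\<^sub>2 :: real
    and f\<^sub>1 f\<^sub>2 g\<^sub>1 g\<^sub>2 h\<^sub>1 h\<^sub>2 :: "real \<Rightarrow> real"
    and u\<^sub>1 u\<^sub>2 :: "real^'n \<Rightarrow> real"
  assumes "m\<^sub>1 \<ge> 1" and "m\<^sub>2 \<ge> 1"
    and "\<And>\<alpha>. \<alpha> \<in> multi_indices m\<^sub>1 \<Longrightarrow> caratheodory (a \<alpha>)"
    and "\<And>\<beta>. \<beta> \<in> multi_indices m\<^sub>2 \<Longrightarrow> caratheodory (b \<beta>)"
    and "A > 0"
    and "\<And>\<alpha> \<beta>. \<alpha> \<in> multi_indices m\<^sub>1 \<Longrightarrow> \<beta> \<in> multi_indices m\<^sub>2 \<Longrightarrow>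
           AE x in lebesgue. \<forall>\<zeta>. \<bar>a \<alpha> x \<zeta>\<bar> + \<bar>b \<beta> x \<zeta>\<bar> \<le> A * \<bar>\<zeta>\<bar>"
    and "nonlinearity f\<^sub>1 lam\<^sub>1 \<mu>\<^sub>1 g\<^sub>1 h\<^sub>1"
    and "nonlinearity f\<^sub>2 lam\<^sub>2 \<mu>\<^sub>2 g\<^sub>2 h\<^sub>2"
    and "\<mu>\<^sub>1 = 1" and "\<mu>\<^sub>2 = 1"
    and "(\<integral>\<^sup>+\<zeta>\<in>{1..}. ennreal
            ((\<zeta> powr (lam\<^sub>1 * lam\<^sub>2) * g\<^sub>1 \<zeta> * g\<^sub>2 \<zeta> powr lam\<^sub>1) powr (- 1 / (real m\<^sub>1 + lam\<^sub>1 * real m\<^sub>2))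
              * \<zeta> powr (1 / (real m\<^sub>1 + lam\<^sub>1 * real m\<^sub>2) - 1)) \<partial>lborel) < \<infinity>"
    and "solution m\<^sub>1 m\<^sub>2 a b f\<^sub>1 f\<^sub>2 u\<^sub>1 u\<^sub>2"
  shows "AE x in lebesgue. u\<^sub>1 x = 0 \<and> u\<^sub>2 x = 0"
proof -
  note m = assms(1,2) and A = assms(5) and ab = assms(6) and nl1 = assms(7) and nl2 = assms(8)
  define F1 where "F1 = (\<lambda>x. f\<^sub>1 \<bar>u\<^sub>2 x\<bar>)"
  define F2 where "F2 = (\<lambda>x. f\<^sub>2 \<bar>u\<^sub>1 x\<bar>)"
  have u: "L1_loc u\<^sub>1" "L1_loc u\<^sub>2" and F: "L1_loc F1" "L1_loc F2"
    and weak: "weak_ineq m\<^sub>1 a u\<^sub>1 F1" "weak_ineq m\<^sub>2 b u\<^sub>2 F2"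
    using assms(12) by (auto simp: solution_def F1_def F2_def)
  have f1: "convex_on {0..} f\<^sub>1" "mono_on {0..} f\<^sub>1" "\<And>\<zeta>. \<zeta> \<ge> 0 \<Longrightarrow> f\<^sub>1 \<zeta> \<ge> 0"
    and f2: "convex_on {0..} f\<^sub>2" "mono_on {0..} f\<^sub>2" "\<And>\<zeta>. \<zeta> \<ge> 0 \<Longrightarrow> f\<^sub>2 \<zeta> \<ge> 0"
    using nl1 nl2 by (auto simp: nonlinearity_def)
  have Fn: "F1 x \<ge> 0" "F2 x \<ge> 0" for x using f1 f2 by (auto simp: F1_def F2_def)
  obtain D1 N1 where s1: "lower_bound_near_0 f\<^sub>1 D1 N1"
    using nonlinearity_lower_bound_near_0 nl1 assms(9) by blast
  obtain D2 N2 where s2: "lower_bound_near_0 f\<^sub>2 D2 N2"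
    using nonlinearity_lower_bound_near_0 nl2 assms(10) by blast
  obtain G1 c1 G2 c2 where l: "lower_bound_at_infinity f\<^sub>1 G1 c1" "lower_bound_at_infinity f\<^sub>2 G2 c2"
    "summable (\<lambda>k. (G1 (2 ^ k) * G2 (2 ^ k)) powr (- 1 / real (m\<^sub>1 + m\<^sub>2)))"
    using ex_summable_lower_bounds[OF _ nl1 nl2 assms(11)] m by auto
  have fpos: "f\<^sub>1 \<zeta> > 0" "f\<^sub>2 \<zeta> > 0" if "\<zeta> > 0" for \<zeta>
    using lower_bound_near_0_imp_pos[OF s1 that] lower_bound_near_0_imp_pos[OF s2 that] by auto
  have bound_a: "AE x in lebesgue. \<bar>a \<alpha> x (u\<^sub>1 x)\<bar> \<le> A * \<bar>u\<^sub>1 x\<bar>" if "\<alpha> \<in> multi_indices m\<^sub>1" for \<alpha>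
  proof -
    \<comment> \<open>The growth condition is stated for pairs, so some multi-index of the other order is needed.\<close>
    obtain \<beta> :: "'n \<Rightarrow> nat" where "\<beta> \<in> multi_indices m\<^sub>2" using multi_indices_nonempty by blast
    from ab[OF that this] show ?thesis
      by eventually_elim (smt (verit) abs_ge_zero)
  qed
  have bound_b: "AE x in lebesgue. \<bar>b \<beta> x (u\<^sub>2 x)\<bar> \<le> A * \<bar>u\<^sub>2 x\<bar>" if "\<beta> \<in> multi_indices m\<^sub>2" for \<beta>
  proof -
    obtain \<alpha> :: "'n \<Rightarrow> nat" where "\<alpha> \<in> multi_indices m\<^sub>1" using multi_indices_nonempty by blast
    from ab[OF this that] show ?thesis
      by eventually_elim (smt (verit) abs_ge_zero)
  qed
  obtain k1 where k1: "k1 > 0" "\<And>c r \<sigma>. 0 < c \<Longrightarrow> c \<le> k1 \<Longrightarrow> 0 < \<sigma> \<Longrightarrow> \<sigma> \<le> r \<Longrightarrow>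
     f\<^sub>2 (c * \<sigma> ^ m\<^sub>1 * cube_average F1 r) \<le> cube_average F2 (r + \<sigma>)"
    using cube_average_step[OF weak(1) A bound_a u(1) F(1) Fn(1) f2(1,2)] F(2) unfolding F2_def by blast
  obtain k2 where k2: "k2 > 0" "\<And>c r \<sigma>. 0 < c \<Longrightarrow> c \<le> k2 \<Longrightarrow> 0 < \<sigma> \<Longrightarrow> \<sigma> \<le> r \<Longrightarrow>
     f\<^sub>1 (c * \<sigma> ^ m\<^sub>2 * cube_average F2 r) \<le> cube_average F1 (r + \<sigma>)"
    using cube_average_step[OF weak(2) A bound_b u(2) F(2) Fn(2) f1(1,2)] F(1) unfolding F1_def by blast
  define c where "c = min k1 k2"
  have c: "c > 0" "c \<le> k1" "c \<le> k2" using k1 k2 by (auto simp: c_def)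
  define n where "n = CARD('n)"
  have zero1: "(LINT x:cube r|lebesgue. F1 x) \<le> 0" if r: "r > 0" for r
  proof (rule ccontr)
    assume "\<not> ?thesis"
    hence pos: "(LINT x:cube r|lebesgue. F1 x) > 0" by simp
    show False
    proof (rule coupled_growth_blow_up[where ?f1.0 = f\<^sub>1 and ?f2.0 = f\<^sub>2 and ?j1.0 = "cube_average F1"
          and ?j2.0 = "cube_average F2" and ?m1.0 = m\<^sub>1 and ?m2.0 = m\<^sub>2 and n = n and c = c
          and a = "(LINT x:cube r|lebesgue. F1 x) / 2 ^ n" and ?r0.0 = r, OF _ _ _ s1 s2 l])
      fix s assume s: "r \<le> s"
      have "(LINT x:cube r|lebesgue. F1 x) / 2 ^ n \<le> (LINT x:cube s|lebesgue. F1 x) / 2 ^ n"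
        using cube_integral_mono[OF F(1) Fn(1) s] by (intro divide_right_mono) auto
      also have "\<dots> = cube_average F1 s * s ^ n"
        using r s by (simp add: cube_average_def n_def power_mult_distrib)
      finally show "(LINT x:cube r|lebesgue. F1 x) / 2 ^ n \<le> cube_average F1 s * s ^ n" .
    next
      fix R :: real assume R: "R > 0"
      show "\<exists>B. \<forall>r\<in>{R..2 * R}. cube_average F1 r \<le> B"
      proof (intro exI ballI)
        fix r assume r: "r \<in> {R..2 * R}"
        show "cube_average F1 r \<le> (LINT x:cube (2 * R)|lebesgue. F1 x) / (2 * R) ^ CARD('n)"
          unfolding cube_average_def using r R cube_integral_mono[OF F(1) Fn(1), of r "2 * R"]
          by (intro frac_le power_mono cube_integral_nonneg Fn) auto
      qed
    qed (use c m k1 k2 pos f1 f2 in \<open>auto simp: mono_on_def n_def Suc_le_eq\<close>)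
  qed
  \<comment> \<open>A positive average of \<open>F2\<close> would force a positive average of \<open>F1\<close> on a larger cube.\<close>
  have zero2: "(LINT x:cube r|lebesgue. F2 x) \<le> 0" if r: "r > 0" for r
  proof (rule ccontr)
    assume "\<not> ?thesis"
    hence "cube_average F2 r > 0" using r by (simp add: cube_average_def)
    hence "f\<^sub>1 (c * r ^ m\<^sub>2 * cube_average F2 r) > 0" using c r by (intro fpos) simp
    hence "cube_average F1 (r + r) > 0" using k2(2)[OF c(1,3) r order_refl] by linarith
    moreover have "cube_average F1 (r + r) \<le> 0"
      unfolding cube_average_def using r by (intro divide_nonpos_pos zero1) auto
    ultimately show False by linarith
  qed
  have "AE x in lebesgue. F1 x = 0" "AE x in lebesgue. F2 x = 0"
    using AE_zero_of_cube_integrals[OF F(1) Fn(1) zero1] AE_zero_of_cube_integrals[OF F(2) Fn(2) zero2] by auto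
  thus ?thesis
  proof eventually_elim
    case (elim x)
    thus ?case using fpos(1)[of "\<bar>u\<^sub>2 x\<bar>"] fpos(2)[of "\<bar>u\<^sub>1 x\<bar>"] by (auto simp: F1_def F2_def)
  qed
qed

end
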